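(* Let $n_1,n_2\ge 0$ be integers and let $P(z_1,z_2)=\sum_{k=-n_1}^{n_1}p_k(z_2)z_1^k$ be a bivariate Laurent polynomial, where each $p_k(z_2)$ is a Laurent polynomial in $z_2$ of degree at most $n_2$ (i.e. a combination of $z_2^j$, $-n_2\le j\le n_2$). Suppose there is $\epsilon>0$ such that $P(z_1,z_2)\ge\epsilon$ for all $|z_1|=|z_2|=1$. Put $C_1=\sup_{-n_1\le i\le n_1,\ |z_2|=1}|p_i(z_2)|$, and let $m_1>n_1$ be an integer such that $$\frac{n_1(n_1+1)\,C_1}{2(m_1-n_1)}<\epsilon .$$ Then there are polynomials $Q_1,\dots,Q_M$ in $z_1,z_2$ with complex coefficients, with $M\le m_1+1$, each of degree at most $m_1$ in $z_1$ and at most $n_2$ in $z_2$, such that $$P(z_1,z_2)=\sum_{k=1}^{M}|Q_k(z_1,z_2)|^2\qquad\text{for all }|z_1|=|z_2|=1 .$$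
   Context: A Laurent polynomial is a finite linear combination, with complex coefficients, of monomials with integer (possibly negative) exponents. A factorization into a "sum of squares of polynomials" means a sum of square magnitudes $|Q_k|^2$ of polynomials (nonnegative exponents only), the equality holding on the bi-torus $|z_1|=|z_2|=1$. *)

theory Defs
  imports Complex_Main "HOL-Library.Poly_Mapping" "HOL-Computational_Algebra.Polynomial"
begin

text \<open>
  A Laurent polynomial in one variable is a finitely supported family of complex
  coefficients indexed by integer exponents. A bivariate one is a Laurent polynomial in
  \<open>z1\<close> whose coefficients are Laurent polynomials in \<open>z2\<close>; the coefficient \<open>p\<^sub>k(z2)\<close> of \<open>z1\<^sup>k\<close>
  is \<open>lookup P k\<close>.
\<close>

type_synonym laurent = "int \<Rightarrow>\<^sub>0 complex"
type_synonym laurent2 = "int \<Rightarrow>\<^sub>0 laurent"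

definition laurent_eval :: "laurent \<Rightarrow> complex \<Rightarrow> complex" where
  "laurent_eval p z = (\<Sum>j\<in>Poly_Mapping.keys p. Poly_Mapping.lookup p j * z powi j)"

definition laurent2_eval :: "laurent2 \<Rightarrow> complex \<Rightarrow> complex \<Rightarrow> complex" where
  "laurent2_eval P z1 z2 =
     (\<Sum>k\<in>Poly_Mapping.keys P. laurent_eval (Poly_Mapping.lookup P k) z2 * z1 powi k)"

text \<open>
  Two-sided degree bound: all exponents lie between \<open>-n\<close> and \<open>n\<close>. It makes sense for
  coefficients of any type, hence also for the outer variable of a bivariate Laurent polynomial.
\<close>

definition laurent_deg_le :: "(int \<Rightarrow>\<^sub>0 'a::zero) \<Rightarrow> nat \<Rightarrow> bool" where
  "laurent_deg_le p n \<longleftrightarrow> Poly_Mapping.keys p \<subseteq> {- int n..int n}"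

text \<open>
  Bivariate polynomials are polynomials in \<open>z1\<close> over the polynomials in \<open>z2\<close>, so \<open>degree Q\<close> is
  the degree in \<open>z1\<close>.
\<close>

definition poly2_eval :: "complex poly poly \<Rightarrow> complex \<Rightarrow> complex \<Rightarrow> complex" where
  "poly2_eval Q z1 z2 = poly (map_poly (\<lambda>q. poly q z2) Q) z1"

definition degree2_le :: "complex poly poly \<Rightarrow> nat \<Rightarrow> bool" where
  "degree2_le Q n \<longleftrightarrow> (\<forall>i. degree (coeff Q i) \<le> n)"

end

theory Submission
  imports Defs "HOL-Analysis.Analysis"
begin

text \<open>
  Put \<open>w\<^sub>k = m\<^sub>1 + 1 - \<bar>k\<bar>\<close>. The \<open>(m\<^sub>1+1) \<times> (m\<^sub>1+1)\<close> Toeplitz matrix with entries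
  \<open>p\<^sub>i\<^sub>-\<^sub>j(z\<^sub>2) / w\<^sub>i\<^sub>-\<^sub>j\<close> has diagonal sums \<open>p\<^sub>k(z\<^sub>2)\<close>, and its symbol is positive: multiplied by \<open>w\<^sub>h\<close>
  with \<open>h = \<lfloor>(n\<^sub>1+1)/2\<rfloor>\<close> it differs from \<open>P\<close> by \<open>\<Sum>\<^sub>k p\<^sub>k (\<bar>k\<bar> - h) z\<^sub>1\<^sup>k / w\<^sub>k\<close>, where
  \<open>\<Sum>\<^sub>k \<bar>\<bar>k\<bar> - h\<bar> = n\<^sub>1(n\<^sub>1+1)/2\<close> because \<open>h\<close> is a median of the \<open>\<bar>k\<bar>\<close>. It remains to factor this
  positive definite matrix polynomial in \<open>z\<^sub>2\<close> as \<open>B B\<^sup>*\<close> with \<open>B\<close> square and of degree \<open>n\<^sub>2\<close>.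

  The same weighting in \<open>z\<^sub>2\<close>, for large \<open>L\<close>, gives a positive definite block Gram matrix with \<open>L + 1\<close>
  block rows. Among all positive semidefinite Gram matrices whose corner block is bounded below
  choose one with maximal corner trace. Eliminating its first block row leaves a Schur complement
  \<open>S\<close>; moving \<open>S\<close> up along the diagonal keeps all block diagonal sums and increases the corner, so
  \<open>S = 0\<close> and the Gram matrix is an outer product of a single block column. Its corner is
  invertible, so the vanishing of the matrix coefficients beyond \<open>n\<^sub>2\<close> forces the degree down to \<open>n\<^sub>2\<close>.
\<close>

section \<open>Positive semidefinite matrices and Schur complements\<close>

text \<open>Matrices are total functions of which only the entries indexed by \<open>I\<close>
  count, so that a principal submatrix arises by shrinking \<open>I\<close> alone.\<close>

definition herm_form :: "'a set \<Rightarrow> ('a \<Rightarrow> 'a \<Rightarrow> complex) \<Rightarrow> ('a \<Rightarrow> complex) \<Rightarrow> complex" where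
  "herm_form I G v = (\<Sum>x\<in>I. \<Sum>y\<in>I. cnj (v x) * G x y * v y)"

text \<open>Hermitian symmetry already makes the form real, so testing its real part loses
  nothing.\<close>

definition psd :: "'a set \<Rightarrow> ('a \<Rightarrow> 'a \<Rightarrow> complex) \<Rightarrow> bool" where
  "psd I G \<longleftrightarrow> (\<forall>x\<in>I. \<forall>y\<in>I. cnj (G x y) = G y x) \<and> (\<forall>v. 0 \<le> Re (herm_form I G v))"

lemma psd_herm: "psd I G \<Longrightarrow> x \<in> I \<Longrightarrow> y \<in> I \<Longrightarrow> cnj (G x y) = G y x"
  by (simp add: psd_def)

lemma psd_form: "psd I G \<Longrightarrow> 0 \<le> Re (herm_form I G v)"
  by (simp add: psd_def)

lemma herm_form_cong:
  assumes "\<And>x y. x \<in> I \<Longrightarrow> y \<in> I \<Longrightarrow> G x y = H x y" "\<And>x. x \<in> I \<Longrightarrow> v x = w x"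
  shows "herm_form I G v = herm_form I H w"
  unfolding herm_form_def using assms by (intro sum.cong refl) auto

lemma psd_cong:
  assumes "\<And>x y. x \<in> I \<Longrightarrow> y \<in> I \<Longrightarrow> G x y = H x y"
  shows "psd I G \<longleftrightarrow> psd I H"
proof -
  have "herm_form I G v = herm_form I H v" for v
    using assms by (intro herm_form_cong) auto
  then show ?thesis using assms by (simp add: psd_def)
qed

lemma herm_form_mono_support:
  assumes "finite I" "J \<subseteq> I" "\<And>x. x \<in> I - J \<Longrightarrow> v x = 0"
  shows "herm_form I G v = herm_form J G v"
proof -
  have "herm_form I G v = (\<Sum>x\<in>I. \<Sum>y\<in>J. cnj (v x) * G x y * v y)"
    unfolding herm_form_def using assms by (intro sum.cong refl sum.mono_neutral_right) auto
  also have "\<dots> = herm_form J G v"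
    unfolding herm_form_def using assms by (intro sum.mono_neutral_right) auto
  finally show ?thesis .
qed

lemma psd_subset:
  assumes "psd I G" "finite I" "J \<subseteq> I"
  shows "psd J G"
  unfolding psd_def
proof (intro conjI allI)
  show "\<forall>x\<in>J. \<forall>y\<in>J. cnj (G x y) = G y x"
    using assms(1,3) by (auto simp: psd_def subset_iff)
next
  fix v :: "_ \<Rightarrow> complex"
  let ?w = "\<lambda>x. if x \<in> J then v x else 0"
  have "herm_form J G v = herm_form J G ?w"
    by (rule herm_form_cong) auto
  also have "\<dots> = herm_form I G ?w"
    using assms by (intro herm_form_mono_support[symmetric]) auto
  finally show "0 \<le> Re (herm_form J G v)"
    using psd_form[OF assms(1)] by simp
qed

lemma herm_form_add:
  "herm_form I (\<lambda>x y. G x y + H x y) v = herm_form I G v + herm_form I H v"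
  by (simp add: herm_form_def algebra_simps sum.distrib)

lemma herm_form_diff:
  "herm_form I (\<lambda>x y. G x y - H x y) v = herm_form I G v - herm_form I H v"
  by (simp add: herm_form_def algebra_simps sum_subtractf)

lemma psd_add: "psd I G \<Longrightarrow> psd I H \<Longrightarrow> psd I (\<lambda>x y. G x y + H x y)"
  by (simp add: psd_def herm_form_add)

text \<open>The form at \<open>v\<close> is the sum over \<open>k\<close> of the squared moduli of
  the pairings of \<open>v\<close> with \<open>q k\<close>.\<close>

lemma psd_outer: "psd I (\<lambda>x y. \<Sum>k\<in>K. q k x * cnj (q k y))"
proof -
  have "herm_form I (\<lambda>x y. \<Sum>k\<in>K. q k x * cnj (q k y)) v
      = (\<Sum>k\<in>K. of_real ((cmod (\<Sum>x\<in>I. cnj (v x) * q k x))\<^sup>2))" for v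
  proof -
    have "herm_form I (\<lambda>x y. \<Sum>k\<in>K. q k x * cnj (q k y)) v
      = (\<Sum>x\<in>I. \<Sum>y\<in>I. \<Sum>k\<in>K. cnj (v x) * q k x * cnj (cnj (v y) * q k y))"
      by (simp add: herm_form_def sum_distrib_left sum_distrib_right mult_ac)
    also have "\<dots> = (\<Sum>x\<in>I. \<Sum>k\<in>K. \<Sum>y\<in>I. cnj (v x) * q k x * cnj (cnj (v y) * q k y))"
      by (rule sum.cong[OF refl], rule sum.swap)
    also have "\<dots> = (\<Sum>k\<in>K. \<Sum>x\<in>I. \<Sum>y\<in>I. cnj (v x) * q k x * cnj (cnj (v y) * q k y))"
      by (rule sum.swap)
    also have "\<dots> = (\<Sum>k\<in>K. (\<Sum>x\<in>I. cnj (v x) * q k x) * cnj (\<Sum>x\<in>I. cnj (v x) * q k x))"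
      by (simp only: cnj_sum sum_product)
    finally show ?thesis by (simp add: complex_norm_square del: of_real_power)
  qed
  then show ?thesis
    by (auto simp: psd_def mult.commute intro!: sum_nonneg sum.cong)
qed

text \<open>Indices that \<open>f\<close> sends outside \<open>I\<close> give zero rows and columns;
  on the others the matrix is a relabelled principal submatrix of \<open>S\<close>. Taking a shift
  for \<open>f\<close> moves a matrix along its diagonal.\<close>

lemma psd_restrict_reindex:
  assumes "psd I S" "finite I" "finite I'" "inj_on f I'"
  shows "psd I' (\<lambda>x y. if f x \<in> I \<and> f y \<in> I then S (f x) (f y) else 0)"
proof -
  define J where "J = {x \<in> I'. f x \<in> I}"
  have injJ: "inj_on f J" using assms(4) by (auto simp: J_def inj_on_def)
  let ?H = "\<lambda>x y. if f x \<in> I \<and> f y \<in> I then S (f x) (f y) else 0"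
  have "0 \<le> Re (herm_form I' ?H v)" for v
  proof -
    have "herm_form I' ?H v = (\<Sum>x\<in>I'. \<Sum>y\<in>J. cnj (v x) * ?H x y * v y)"
      unfolding herm_form_def using assms(3)
      by (intro sum.cong refl sum.mono_neutral_right) (auto simp: J_def)
    also have "\<dots> = herm_form J ?H v"
      unfolding herm_form_def using assms(3)
      by (intro sum.mono_neutral_right) (auto simp: J_def intro!: sum.neutral)
    also have "\<dots> = herm_form J (\<lambda>x y. S (f x) (f y)) v"
      by (rule herm_form_cong) (auto simp: J_def)
    also have "\<dots> = herm_form (f ` J) S (\<lambda>z. v (the_inv_into J f z))"
      using injJ by (simp add: herm_form_def sum.reindex the_inv_into_f_f)
    finally show ?thesis
      using psd_form[OF psd_subset[OF assms(1,2), of "f ` J"]] by (auto simp: J_def)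
  qed
  then show ?thesis
    using psd_herm[OF assms(1)] by (auto simp: psd_def)
qed

lemma psd_diag:
  assumes "psd I G" "finite I" "x \<in> I"
  shows "G x x = of_real (Re (G x x))" "0 \<le> Re (G x x)"
proof -
  have "cnj (G x x) = G x x" using psd_herm[OF assms(1,3,3)] .
  then show "G x x = of_real (Re (G x x))"
    by (auto simp: complex_eq_iff)
  have "psd {x} G" by (rule psd_subset[OF assms(1,2)]) (use assms in auto)
  from psd_form[OF this, of "\<lambda>_. 1"] show "0 \<le> Re (G x x)"
    by (simp add: herm_form_def)
qed

text \<open>The form is evaluated at a vector supported on \<open>x\<close> and \<open>y\<close>
  whose phase makes the cross terms negative. The value \<open>t = 1\<close> bounds entries by
  diagonal entries; large \<open>t\<close> serves when \<open>G x x\<close> vanishes.\<close>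

lemma psd_entry:
  assumes "psd I G" "finite I" "x \<in> I" "y \<in> I"
  shows "2 * t * cmod (G x y) \<le> t\<^sup>2 * Re (G x x) + Re (G y y)"
proof (cases "x = y")
  case True
  have "cmod (G x x) = Re (G x x)" "0 \<le> Re (G x x)"
    using psd_diag[OF assms(1,2,3)] by (metis norm_of_real abs_of_nonneg)+
  moreover have "0 \<le> (t - 1)\<^sup>2 * Re (G x x)" using calculation by simp
  ultimately show ?thesis using True by (simp add: power2_eq_square algebra_simps)
next
  case False
  \<comment> \<open>The unimodular \<open>u\<close> turns \<open>G x y\<close> to the negative real
    axis.\<close>
  obtain u where u: "cmod u = 1" "u * G x y = - of_real (cmod (G x y))"
  proof (cases "G x y = 0")
    case True then show ?thesis by (intro that[of 1]) auto
  next
    case False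
    show ?thesis
      using False that[of "- cnj (G x y) / cmod (G x y)"]
      by (simp add: norm_divide norm_mult complex_norm_square[symmetric] power2_eq_square field_simps
          flip: of_real_mult)
  qed
  have psd2: "psd {x, y} G" by (rule psd_subset[OF assms(1,2)]) (use assms in auto)
  let ?v = "\<lambda>z. if z = x then of_real t * cnj u else 1"
  have yx: "cnj (G x y) = G y x" using psd_herm[OF assms(1,3,4)] .
  have "cnj u * G y x = cnj (u * G x y)" using yx by simp
  then have c: "cnj u * G y x = - of_real (cmod (G x y))" unfolding u by simp
  have uu: "u * cnj u = 1" using u by (metis complex_norm_square mult_1 of_real_1 power2_eq_square)
  have "herm_form {x, y} G ?v = of_real (t\<^sup>2) * G x x * (u * cnj u) + of_real t * (u * G x y)
     + of_real t * (cnj u * G y x) + G y y"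
    using False by (simp add: herm_form_def power2_eq_square algebra_simps)
  also have "\<dots> = of_real (t\<^sup>2) * G x x - of_real (2 * t * cmod (G x y)) + G y y"
    unfolding u c uu by simp
  finally have "Re (herm_form {x, y} G ?v) = t\<^sup>2 * Re (G x x) - 2 * t * cmod (G x y) + Re (G y y)"
    by (simp del: of_real_power of_real_mult)
  with psd_form[OF psd2, of ?v] show ?thesis by simp
qed

lemma psd_zero_diag:
  assumes "psd I G" "finite I" "x \<in> I" "y \<in> I" "G x x = 0"
  shows "G x y = 0" "G y x = 0"
proof -
  have le: "2 * t * cmod (G x y) \<le> Re (G y y)" for t
    using psd_entry[OF assms(1-4), of t] assms(5) by simp
  show "G x y = 0"
  proof (rule ccontr)
    assume "G x y \<noteq> 0"
    then show False
      \<comment> \<open>This \<open>t\<close> makes the left-hand side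
        \<open>Re (G y y) + 1\<close>, a contradiction.\<close>
      using le[of "(Re (G y y) + 1) / (2 * cmod (G x y))"] by simp
  qed
  then show "G y x = 0" using psd_herm[OF assms(1), of x y] assms by simp
qed

text \<open>If the pivot \<open>G p p\<close> is zero, division by zero makes this column zero, as it should be.\<close>

definition schur_col :: "('a \<Rightarrow> 'a \<Rightarrow> complex) \<Rightarrow> 'a \<Rightarrow> 'a \<Rightarrow> complex" where
  "schur_col G p x = G x p / of_real (sqrt (Re (G p p)))"

text \<open>Completing the square: subtracting the outer product of the pivot column has the same
  effect as changing the coordinate \<open>p\<close> of \<open>v\<close> so that the form of
  \<open>G\<close> becomes minimal. Both positivity and lower bounds thus pass to the Schur
  complement.\<close>

lemma schur_form:
  assumes "psd I G" "finite I" "p \<in> I" "Re (G p p) > 0"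
  defines "t \<equiv> \<lambda>v. (\<Sum>y\<in>I. G p y * v y) / G p p"
  shows "herm_form I (\<lambda>x y. G x y - schur_col G p x * cnj (schur_col G p y)) v
       = herm_form I G (\<lambda>x. v x - (if x = p then t v else 0))"
proof -
  define g where "g = G p p"
  have g: "g \<noteq> 0" "cnj g = g" "of_real (Re g) = g"
    using psd_diag[OF assms(1-3)] assms(4) by (auto simp: g_def complex_eq_iff)
  define B where "B = (\<Sum>y\<in>I. G p y * v y)"
  have tv: "t v = B / g" by (simp add: t_def B_def g_def)
  have Bc: "(\<Sum>x\<in>I. cnj (v x) * G x p) = cnj B"
    unfolding B_def cnj_sum
    by (intro sum.cong refl) (use psd_herm[OF assms(1) assms(3)] in auto)
  have col: "schur_col G p x * cnj (schur_col G p y) = G x p * G p y / g" if "x \<in> I" "y \<in> I" for x y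
  proof -
    have "of_real (sqrt (Re g)) * of_real (sqrt (Re g)) = g"
      using assms(4) g by (metis g_def less_imp_le of_real_mult real_sqrt_mult_self abs_of_pos)
    then show ?thesis
      using psd_herm[OF assms(1) that(2) assms(3)] by (simp add: schur_col_def g_def)
  qed
  have outer: "herm_form I (\<lambda>x y. schur_col G p x * cnj (schur_col G p y)) v = cnj B * B / g"
  proof -
    have "herm_form I (\<lambda>x y. schur_col G p x * cnj (schur_col G p y)) v
        = (\<Sum>x\<in>I. \<Sum>y\<in>I. (cnj (v x) * G x p) * (G p y * v y) / g)"
      unfolding herm_form_def by (intro sum.cong refl) (simp add: col)
    also have "\<dots> = (\<Sum>x\<in>I. cnj (v x) * G x p) * (\<Sum>y\<in>I. G p y * v y) / g"
      by (simp add: sum_product sum_divide_distrib)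
    finally show ?thesis by (simp add: Bc B_def)
  qed
  let ?e = "\<lambda>x. if x = p then t v else 0"
  have e1: "(\<Sum>x\<in>I. \<Sum>y\<in>I. cnj (v x) * G x y * ?e y) = cnj B * t v"
    using assms(2,3) by (simp add: sum.delta if_distrib[of "\<lambda>z. _ * z"] sum_distrib_right[symmetric] Bc cong: if_cong)
  have e2: "(\<Sum>x\<in>I. \<Sum>y\<in>I. cnj (?e x) * G x y * v y) = cnj (t v) * B"
  proof -
    have "(\<Sum>x\<in>I. \<Sum>y\<in>I. cnj (?e x) * G x y * v y) = (\<Sum>x\<in>I. if x = p then \<Sum>y\<in>I. cnj (t v) * G x y * v y else 0)"
      by (intro sum.cong refl) auto
    then show ?thesis
      using assms(2,3) by (simp add: sum_distrib_left B_def mult_ac)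
  qed
  have e3: "(\<Sum>x\<in>I. \<Sum>y\<in>I. cnj (?e x) * G x y * ?e y) = cnj (t v) * g * t v"
  proof -
    have "(\<Sum>x\<in>I. \<Sum>y\<in>I. cnj (?e x) * G x y * ?e y)
       = (\<Sum>x\<in>I. if x = p then \<Sum>y\<in>I. if y = p then cnj (t v) * G x y * t v else 0 else 0)"
      by (intro sum.cong refl) (auto intro!: sum.cong)
    then show ?thesis
      using assms(2,3) by (simp add: g_def)
  qed
  have "herm_form I G (\<lambda>x. v x - ?e x) = herm_form I G v - cnj B * t v - cnj (t v) * B + cnj (t v) * g * t v"
    unfolding e1[symmetric] e2[symmetric] e3[symmetric] herm_form_def
    by (simp only: sum_subtractf[symmetric] sum.distrib[symmetric])
      (intro sum.cong refl, simp add: algebra_simps)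
  also have "\<dots> = herm_form I G v - cnj B * B / g"
    using g by (simp add: tv field_simps)
  finally show ?thesis
    by (simp add: herm_form_diff outer)
qed

lemma schur_herm:
  assumes "psd I G" "x \<in> I" "y \<in> I"
  shows "cnj (G x y - schur_col G p x * cnj (schur_col G p y))
       = G y x - schur_col G p y * cnj (schur_col G p x)"
  using psd_herm[OF assms] by simp

lemma psd_schur:
  assumes "psd I G" "finite I" "p \<in> I"
  shows "psd I (\<lambda>x y. G x y - schur_col G p x * cnj (schur_col G p y))"
proof (cases "Re (G p p) > 0")
  case True
  show ?thesis
    unfolding psd_def schur_form[OF assms True]
    using psd_form[OF assms(1)] schur_herm[OF assms(1)] by (intro conjI ballI allI) simp_all
next
  case False
  then have "Re (G p p) = 0" using psd_diag(2)[OF assms] by simp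
  then have "schur_col G p x = 0" for x by (simp add: schur_col_def)
  then show ?thesis using assms(1) by simp
qed

lemma schur_pivot:
  assumes "psd I G" "finite I" "p \<in> I"
  shows "G p p - schur_col G p p * cnj (schur_col G p p) = 0"
proof -
  define r where "r = Re (G p p)"
  have r: "G p p = of_real r" "0 \<le> r" using psd_diag[OF assms] by (auto simp: r_def)
  show ?thesis
    unfolding schur_col_def r using r(2)
    by (cases "r = 0") (auto simp: real_sqrt_mult_self power2_eq_square field_simps simp flip: of_real_mult)
qed


section \<open>Uniform lower bounds and block elimination\<close>

text \<open>This is \<open>c\<close> times the identity, so
  \<open>psd I (\<lambda>x y. G x y - delta c x y)\<close> says that \<open>G\<close> is bounded
  below by \<open>c\<close> on \<open>I\<close>.\<close>

definition delta :: "real \<Rightarrow> 'a \<Rightarrow> 'a \<Rightarrow> complex" where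
  "delta c x y = (if x = y then of_real c else 0)"

lemma herm_form_delta:
  assumes "finite I"
  shows "herm_form I (delta c) v = of_real (c * (\<Sum>x\<in>I. (cmod (v x))\<^sup>2))"
proof -
  have "herm_form I (delta c) v = (\<Sum>x\<in>I. \<Sum>y\<in>I. if x = y then cnj (v x) * of_real c * v x else 0)"
    unfolding herm_form_def by (intro sum.cong refl) (auto simp: delta_def)
  also have "\<dots> = (\<Sum>x\<in>I. of_real c * (v x * cnj (v x)))"
    using assms by (simp add: mult_ac)
  also have "\<dots> = of_real (c * (\<Sum>x\<in>I. (cmod (v x))\<^sup>2))"
    by (simp add: complex_norm_square[symmetric] sum_distrib_left)
  finally show ?thesis .
qed

lemma psd_delta_iff:
  assumes "finite I"
  shows "psd I (\<lambda>x y. G x y - delta c x y) \<longleftrightarrow>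
    (\<forall>x\<in>I. \<forall>y\<in>I. cnj (G x y) = G y x) \<and>
    (\<forall>v. c * (\<Sum>x\<in>I. (cmod (v x))\<^sup>2) \<le> Re (herm_form I G v))"
proof -
  have "cnj (G x y - delta c x y) = G y x - delta c y x \<longleftrightarrow> cnj (G x y) = G y x" for x y
    by (auto simp: delta_def)
  then show ?thesis
    by (simp add: psd_def herm_form_diff herm_form_delta assms)
qed

text \<open>The Schur complement at \<open>v\<close> equals the form of \<open>G\<close> at
  \<open>v\<close> extended by one coordinate at \<open>p\<close>. The extension does not decrease
  the norm, so the same \<open>c\<close> remains a lower bound on \<open>J\<close>.\<close>

lemma psd_schur_delta:
  assumes "psd I G" "finite I" "insert p J \<subseteq> I" "p \<notin> J" "c > 0"
    and "psd (insert p J) (\<lambda>x y. G x y - delta c x y)"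
  shows "Re (G p p) > 0"
    and "psd J (\<lambda>x y. (G x y - schur_col G p x * cnj (schur_col G p y)) - delta c x y)"
proof -
  have fin: "finite (insert p J)" using assms(2,3) by (rule rev_finite_subset)
  have low: "c * (\<Sum>x\<in>insert p J. (cmod (v x))\<^sup>2) \<le> Re (herm_form (insert p J) G v)" for v
    using iffD1[OF psd_delta_iff[OF fin] assms(6)] by simp
  have psdJ: "psd (insert p J) G" by (rule psd_subset[OF assms(1-3)])
  show pos: "Re (G p p) > 0"
  proof -
    have "psd {p} (\<lambda>x y. G x y - delta c x y)"
      by (rule psd_subset[OF assms(6) fin]) auto
    from psd_diag(2)[OF this, of p] show ?thesis
      using assms(5) by (simp add: delta_def)
  qed
  let ?S = "\<lambda>x y. G x y - schur_col G p x * cnj (schur_col G p y)"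
  have "c * (\<Sum>x\<in>J. (cmod (v x))\<^sup>2) \<le> Re (herm_form J ?S v)" for v
  proof -
    \<comment> \<open>Since \<open>w p = 0\<close>, the vector
      \<open>w x - (if x = p then t else 0)\<close> agrees with \<open>v\<close> on \<open>J\<close>
      and has the coordinate \<open>-t\<close> at \<open>p\<close>.\<close>
    define w where "w x = (if x \<in> J then v x else 0)" for x
    obtain t where t: "herm_form (insert p J) ?S w = herm_form (insert p J) G (\<lambda>x. w x - (if x = p then t else 0))"
      using schur_form[OF psdJ fin _ pos, of w] by auto
    have "herm_form J ?S v = herm_form J ?S w"
      by (rule herm_form_cong) (auto simp: w_def)
    also have "\<dots> = herm_form (insert p J) ?S w"
      using fin assms(4) by (intro herm_form_mono_support[symmetric]) (auto simp: w_def)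
    finally have eq: "Re (herm_form J ?S v) = Re (herm_form (insert p J) G (\<lambda>x. w x - (if x = p then t else 0)))"
      using t by simp
    have "(\<Sum>x\<in>J. (cmod (v x))\<^sup>2) = (\<Sum>x\<in>J. (cmod (w x - (if x = p then t else 0)))\<^sup>2)"
      using assms(4) by (intro sum.cong refl) (auto simp: w_def)
    also have "\<dots> \<le> (\<Sum>x\<in>insert p J. (cmod (w x - (if x = p then t else 0)))\<^sup>2)"
      using fin by (intro sum_mono2) auto
    finally have "c * (\<Sum>x\<in>J. (cmod (v x))\<^sup>2)
        \<le> c * (\<Sum>x\<in>insert p J. (cmod (w x - (if x = p then t else 0)))\<^sup>2)"
      using assms(5) by (intro mult_left_mono) simp_all
    then show ?thesis
      unfolding eq by (rule order_trans[OF _ low])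
  qed
  moreover have "cnj (?S x y) = ?S y x" if "x \<in> J" "y \<in> J" for x y
    using that by (intro schur_herm[OF psdJ]) auto
  ultimately show "psd J (\<lambda>x y. ?S x y - delta c x y)"
    using fin by (subst psd_delta_iff) auto
qed

text \<open>Pivots in \<open>J\<close> are eliminated one at a time; the bound \<open>c\<close> is
  inherited, so each pivot is positive. The last conjunct expresses invertibility of the corner of
  the factor, which holds because that corner is triangular with nonzero diagonal.\<close>

lemma block_elimination:
  assumes "finite J" "psd I G" "finite I" "J \<subseteq> I" "c > 0"
    and "psd J (\<lambda>x y. G x y - delta c x y)"
  shows "\<exists>q S. psd I S
    \<and> (\<forall>x\<in>I. \<forall>y\<in>I. G x y = (\<Sum>k\<in>J. q k x * cnj (q k y)) + S x y)
    \<and> (\<forall>x\<in>J. \<forall>y\<in>I. S x y = 0 \<and> S y x = 0)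
    \<and> (\<forall>u. (\<forall>j\<in>J. (\<Sum>k\<in>J. u k * cnj (q k j)) = 0) \<longrightarrow> (\<forall>k\<in>J. u k = 0))"
  using assms
proof (induction J arbitrary: G rule: finite_induct)
  case empty
  then show ?case by (intro exI[of _ "\<lambda>_ _. 0"] exI[of _ G]) auto
next
  case (insert p J)
  let ?s = "schur_col G p"
  define H where "H = (\<lambda>x y. G x y - ?s x * cnj (?s y))"
  have pI: "p \<in> I" using insert.prems by auto
  have H: "psd I H" unfolding H_def by (rule psd_schur[OF insert.prems(1,2) pI])
  note sd = psd_schur_delta[OF insert.prems(1,2,3) insert.hyps(2) insert.prems(4,5)]
  have HJ: "psd J (\<lambda>x y. H x y - delta c x y)" using sd(2) by (simp only: H_def)
  have JI: "J \<subseteq> I" using insert.prems(3) by auto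
  obtain q S where qS: "psd I S"
    "\<And>x y. x \<in> I \<Longrightarrow> y \<in> I \<Longrightarrow> H x y = (\<Sum>k\<in>J. q k x * cnj (q k y)) + S x y"
    "\<And>x y. x \<in> J \<Longrightarrow> y \<in> I \<Longrightarrow> S x y = 0 \<and> S y x = 0"
    "\<And>u. (\<And>j. j \<in> J \<Longrightarrow> (\<Sum>k\<in>J. u k * cnj (q k j)) = 0) \<Longrightarrow> (\<forall>k\<in>J. u k = 0)"
    using insert.IH[OF H insert.prems(2) JI insert.prems(4) HJ] by auto
  \<comment> \<open>The eliminated diagonal entry is zero, yet it is a sum of nonnegative terms.
    Hence all later columns and the remainder vanish at \<open>p\<close>, which gives the triangular
    shape.\<close>
  have "0 = H p p" unfolding H_def by (rule schur_pivot[OF insert.prems(1,2) pI, symmetric])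
  also have "\<dots> = (\<Sum>k\<in>J. q k p * cnj (q k p)) + S p p" by (rule qS(2)[OF pI pI])
  also have "\<dots> = of_real ((\<Sum>k\<in>J. (cmod (q k p))\<^sup>2) + Re (S p p))"
    using psd_diag(1)[OF qS(1) insert.prems(2) pI]
    by (simp add: complex_norm_square del: of_real_power)
  finally have "(\<Sum>k\<in>J. (cmod (q k p))\<^sup>2) + Re (S p p) = 0"
    by (metis of_real_eq_0_iff)
  moreover have "0 \<le> Re (S p p)" by (rule psd_diag(2)[OF qS(1) insert.prems(2) pI])
  moreover have "0 \<le> (\<Sum>k\<in>J. (cmod (q k p))\<^sup>2)" by (intro sum_nonneg) auto
  ultimately have "Re (S p p) = 0" and "(\<Sum>k\<in>J. (cmod (q k p))\<^sup>2) = 0" by linarith+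
  then have Spp: "S p p = 0" and qp: "\<And>k. k \<in> J \<Longrightarrow> q k p = 0"
    using psd_diag(1)[OF qS(1) insert.prems(2) pI] insert.hyps(1)
    by (auto simp: sum_nonneg_eq_0_iff)
  define q' where "q' = q(p := ?s)"
  have q'J: "(\<Sum>k\<in>insert p J. u k * F (q' k)) = u p * F ?s + (\<Sum>k\<in>J. u k * F (q k))" for u and F :: "_ \<Rightarrow> complex"
    using insert.hyps by (auto simp: q'_def intro!: sum.cong)
  have q'J2: "(\<Sum>k\<in>insert p J. q' k x * cnj (q' k y)) = ?s x * cnj (?s y) + (\<Sum>k\<in>J. q k x * cnj (q k y))" for x y
    using insert.hyps by (auto simp: q'_def intro!: sum.cong)
  have sp: "?s p \<noteq> 0"
    using sd(1) by (auto simp: schur_col_def)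
  show ?case
  proof (rule exI[of _ q'], rule exI[of _ S], intro conjI ballI allI impI)
    show "psd I S" by fact
    show "G x y = (\<Sum>k\<in>insert p J. q' k x * cnj (q' k y)) + S x y" if "x \<in> I" "y \<in> I" for x y
      using qS(2)[OF that] by (simp add: q'J2 H_def algebra_simps)
    show "S x y = 0" "S y x = 0" if "x \<in> insert p J" "y \<in> I" for x y
      using that qS(3) psd_zero_diag[OF qS(1) insert.prems(2) pI that(2) Spp] by auto
    fix u k assume u: "\<forall>j\<in>insert p J. (\<Sum>k\<in>insert p J. u k * cnj (q' k j)) = 0" and k: "k \<in> insert p J"
    have eq: "u p * cnj (?s j) + (\<Sum>k\<in>J. u k * cnj (q k j)) = 0" if "j \<in> insert p J" for j
      unfolding q'J[of u "\<lambda>f. cnj (f j)", symmetric] using u that by blast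
    \<comment> \<open>At the index \<open>p\<close> only the new column contributes, which forces
      \<open>u p = 0\<close>; the other equations then reduce to the induction hypothesis.\<close>
    have "(\<Sum>k\<in>J. u k * cnj (q k p)) = 0" using qp by (intro sum.neutral) auto
    then have up: "u p = 0" using eq[of p] sp by simp
    then show "u k = 0" using qS(4)[of u] eq k by auto
  qed
qed

section \<open>Extremal block Gram matrices\<close>

text \<open>
  In an index \<open>(i, a)\<close> the number \<open>a\<close> (the exponent of \<open>z\<^sub>2\<close>) selects the block and \<open>i\<close> (the exponent
  of \<open>z\<^sub>1\<close>) the position inside it; \<open>block_grid m 0\<close> indexes the corner block.
\<close>

definition block_grid :: "nat \<Rightarrow> nat \<Rightarrow> (nat \<times> nat) set" where
  "block_grid m L = {..m} \<times> {..L}"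

text \<open>For fixed \<open>i\<close> and \<open>j\<close> this is the coefficient of
  \<open>z2 powi l\<close> in the entry \<open>(i, j)\<close> of the matrix Laurent polynomial that
  the block matrix represents.\<close>

definition block_diag_sum ::
    "nat \<Rightarrow> (nat \<times> nat \<Rightarrow> nat \<times> nat \<Rightarrow> complex) \<Rightarrow> int \<Rightarrow> nat \<Rightarrow> nat \<Rightarrow> complex" where
  "block_diag_sum L G l i j =
     (\<Sum>a\<le>L. \<Sum>b\<le>L. if int a - int b = l then G (i, a) (j, b) else 0)"

text \<open>The bound \<open>c\<close> on the corner block survives the maximisation and makes the corner invertible.\<close>

definition gram ::
    "nat \<Rightarrow> nat \<Rightarrow> real \<Rightarrow> (int \<Rightarrow> nat \<Rightarrow> nat \<Rightarrow> complex) \<Rightarrow> (nat \<times> nat \<Rightarrow> nat \<times> nat \<Rightarrow> complex) \<Rightarrow> bool" where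
  "gram m L c A G \<longleftrightarrow> psd (block_grid m L) G
     \<and> psd (block_grid m 0) (\<lambda>x y. G x y - delta c x y)
     \<and> (\<forall>l. \<forall>i\<le>m. \<forall>j\<le>m. block_diag_sum L G l i j = A l i j)"

lemma finite_block_grid [simp]: "finite (block_grid m L)"
  by (simp add: block_grid_def)

lemma mem_block_grid [simp]: "(i, a) \<in> block_grid m L \<longleftrightarrow> i \<le> m \<and> a \<le> L"
  by (simp add: block_grid_def)

lemma block_grid_mono: "block_grid m 0 \<subseteq> block_grid m L"
  by (auto simp: block_grid_def)

lemma block_diag_sum_cong:
  assumes "\<And>a b. a \<le> L \<Longrightarrow> b \<le> L \<Longrightarrow> G (i, a) (j, b) = H (i, a) (j, b)"
  shows "block_diag_sum L G l i j = block_diag_sum L H l i j"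
  unfolding block_diag_sum_def by (intro sum.cong refl) (use assms in auto)

lemma gram_cong:
  assumes "\<And>x y. x \<in> block_grid m L \<Longrightarrow> y \<in> block_grid m L \<Longrightarrow> G x y = H x y"
  shows "gram m L c A G \<longleftrightarrow> gram m L c A H"
proof -
  have 1: "psd (block_grid m L) G \<longleftrightarrow> psd (block_grid m L) H"
    by (rule psd_cong) (rule assms)
  have 2: "psd (block_grid m 0) (\<lambda>x y. G x y - delta c x y) \<longleftrightarrow> psd (block_grid m 0) (\<lambda>x y. H x y - delta c x y)"
    by (rule psd_cong) (use assms block_grid_mono[of m L] in auto)
  have 3: "block_diag_sum L G l i j = block_diag_sum L H l i j" if "i \<le> m" "j \<le> m" for l i j
    by (rule block_diag_sum_cong) (use assms that in auto)
  show ?thesis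
    unfolding gram_def 1 2 using 3 by auto
qed

text \<open>The diagonal entries \<open>G (i, b) (i, b)\<close> are nonnegative and add up to the
  prescribed \<open>A 0 i i\<close>.\<close>

lemma gram_diag_bound:
  assumes "gram m L c A G" "(i, a) \<in> block_grid m L"
  shows "Re (G (i, a) (i, a)) \<le> cmod (A 0 i i)"
proof -
  have p: "psd (block_grid m L) G" using assms by (simp add: gram_def)
  have ia: "i \<le> m" "a \<le> L" using assms(2) by auto
  have "A 0 i i = block_diag_sum L G 0 i i"
    using assms ia by (simp add: gram_def)
  also have "\<dots> = (\<Sum>b\<le>L. G (i, b) (i, b))"
    unfolding block_diag_sum_def by (intro sum.cong refl) simp
  finally have "Re (A 0 i i) = (\<Sum>b\<le>L. Re (G (i, b) (i, b)))" by simp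
  also have "\<dots> \<ge> Re (G (i, a) (i, a))"
    using ia psd_diag(2)[OF p] by (intro member_le_sum) auto
  finally show ?thesis
    using complex_Re_le_cmod order_trans by blast
qed

text \<open>A bound depending on \<open>A\<close> only: it confines all competitors of the
  maximisation to one compact set.\<close>

lemma gram_entry_bound:
  assumes "gram m L c A G" "x \<in> block_grid m L" "y \<in> block_grid m L"
  shows "cmod (G x y) \<le> (\<Sum>i\<le>m. cmod (A 0 i i))"
proof -
  have p: "psd (block_grid m L) G" using assms by (simp add: gram_def)
  have d: "Re (G z z) \<le> (\<Sum>i\<le>m. cmod (A 0 i i))" if "z \<in> block_grid m L" for z
  proof -
    have "fst z \<le> m" using that by (auto simp: block_grid_def)
    then have "cmod (A 0 (fst z) (fst z)) \<le> (\<Sum>i\<le>m. cmod (A 0 i i))"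
      by (intro member_le_sum) auto
    then show ?thesis
      using gram_diag_bound[OF assms(1), of "fst z" "snd z"] that by simp
  qed
  show ?thesis
    using psd_entry[OF p finite_block_grid assms(2,3), of 1] d[OF assms(2)] d[OF assms(3)] by simp
qed

section \<open>Existence of a Gram matrix with maximal corner trace\<close>

definition corner_trace :: "nat \<Rightarrow> (nat \<times> nat \<Rightarrow> nat \<times> nat \<Rightarrow> complex) \<Rightarrow> real" where
  "corner_trace m G = (\<Sum>i\<le>m. Re (G (i, 0) (i, 0)))"

lemma closed_psd:
  assumes "\<And>x y. x \<in> I \<Longrightarrow> y \<in> I \<Longrightarrow> continuous_on UNIV (\<lambda>F. G F x y)"
  shows "closed {F. psd I (G F)}"
proof -
  have "{F. psd I (G F)} =
      (\<Inter>x\<in>I. \<Inter>y\<in>I. {F. cnj (G F x y) = G F y x}) \<inter> (\<Inter>v. {F. 0 \<le> Re (herm_form I (G F) v)})"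
    by (auto simp: psd_def)
  moreover have "closed {F. cnj (G F x y) = G F y x}" if "x \<in> I" "y \<in> I" for x y
    using that by (intro closed_Collect_eq continuous_on_cnj assms)
  moreover have "closed {F. 0 \<le> Re (herm_form I (G F) v)}" for v
    unfolding herm_form_def
    by (intro closed_Collect_le continuous_on_const continuous_on_Re continuous_on_sum
        continuous_on_mult assms)
  ultimately show ?thesis by (auto intro!: closed_Int closed_INT)
qed

text \<open>Tychonoff's theorem: the set is a product of closed discs, and function types carry the
  product topology.\<close>

lemma compact_bounded_functions: "compact {F :: 'i \<Rightarrow> complex. \<forall>z. cmod (F z) \<le> B}"
proof -
  have "compactin (product_topology (\<lambda>_. euclidean) UNIV) (Pi\<^sub>E UNIV (\<lambda>_ :: 'i. cball (0 :: complex) B))"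
    by (simp add: compactin_PiE)
  moreover have "Pi\<^sub>E UNIV (\<lambda>_ :: 'i. cball (0 :: complex) B) = {F. \<forall>z. cmod (F z) \<le> B}"
    by (auto simp: PiE_def Pi_def extensional_def)
  ultimately show ?thesis
    by (simp add: euclidean_product_topology)
qed

lemma gram_maximizer:
  assumes "gram m L c A G0"
  shows "\<exists>G. gram m L c A G \<and> (\<forall>H. gram m L c A H \<longrightarrow> corner_trace m H \<le> corner_trace m G)"
proof -
  define B where "B = (\<Sum>i\<le>m. cmod (A 0 i i))"
  \<comment> \<open>Currying lets matrices be points of a single product space indexed by pairs of
    indices.\<close>
  define K where "K = {F. \<forall>z. cmod (F z) \<le> B} \<inter> {F. gram m L c A (curry F)}"
  have cont: "continuous_on UNIV (\<lambda>F :: (nat \<times> nat) \<times> (nat \<times> nat) \<Rightarrow> complex. F z)" for z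
    by (rule continuous_on_product_coordinates)
  have "{F. gram m L c A (curry F)} = {F. psd (block_grid m L) (curry F)}
      \<inter> {F. psd (block_grid m 0) (\<lambda>x y. curry F x y - delta c x y)}
      \<inter> (\<Inter>l. \<Inter>i\<in>{..m}. \<Inter>j\<in>{..m}. {F. block_diag_sum L (curry F) l i j = A l i j})"
    by (auto simp: gram_def)
  moreover have "closed {F. psd (block_grid m L) (curry F)}"
    by (rule closed_psd) (simp add: cont)
  moreover have "closed {F. psd (block_grid m 0) (\<lambda>x y. curry F x y - delta c x y)}"
    by (rule closed_psd) (simp add: cont continuous_on_diff)
  moreover have "continuous_on UNIV (\<lambda>F. block_diag_sum L (curry F) l i j)" for l i j
  proof -
    have "continuous_on UNIV (\<lambda>F :: (nat \<times> nat) \<times> (nat \<times> nat) \<Rightarrow> complex.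
        if int a - int b = l then F ((i, a), (j, b)) else 0)" for a b
      by (cases "int a - int b = l") (simp_all add: cont)
    then show ?thesis
      unfolding block_diag_sum_def curry_def by (intro continuous_on_sum)
  qed
  ultimately have "closed {F. gram m L c A (curry F)}"
    by (auto intro!: closed_Int closed_INT closed_Collect_eq)
  then have "compact K"
    unfolding K_def using compact_bounded_functions by (rule compact_Int_closed[rotated])
  moreover have norm: "\<exists>F\<in>K. corner_trace m (curry F) = corner_trace m H" if "gram m L c A H" for H
  proof -
    \<comment> \<open>\<open>gram\<close> does not constrain entries outside the grid. They are
      reset to zero so that the bound \<open>B\<close> holds everywhere and \<open>F\<close> lies in
      \<open>K\<close>.\<close>
    define F where "F = (\<lambda>(x, y). if x \<in> block_grid m L \<and> y \<in> block_grid m L then H x y else 0)"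
    have "gram m L c A (curry F)"
      using that by (subst gram_cong[where H = H]) (auto simp: F_def)
    moreover have "0 \<le> B" by (auto simp: B_def intro: sum_nonneg)
    then have "cmod (F z) \<le> B" for z
      using gram_entry_bound[OF that] by (auto simp: F_def B_def split: prod.split)
    ultimately have "F \<in> K" by (simp add: K_def)
    moreover have "corner_trace m (curry F) = corner_trace m H"
      by (simp add: corner_trace_def F_def)
    ultimately show ?thesis by blast
  qed
  moreover have "K \<noteq> {}" using norm[OF assms] by blast
  moreover have "continuous_on K (\<lambda>F. corner_trace m (curry F))"
    unfolding corner_trace_def curry_def
    by (intro continuous_on_sum continuous_on_Re continuous_on_subset[OF cont]) simp
  ultimately obtain F where F: "F \<in> K" "\<forall>H\<in>K. corner_trace m (curry H) \<le> corner_trace m (curry F)"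
    using continuous_attains_sup by blast
  have "corner_trace m H \<le> corner_trace m (curry F)" if "gram m L c A H" for H
    using norm[OF that] F(2) by metis
  then show ?thesis
    using F(1) by (intro exI[of _ "curry F"]) (simp add: K_def)
qed

section \<open>Shifting the remainder, and the rank of the extremal matrix\<close>

definition shift_block :: "nat \<Rightarrow> nat \<times> nat \<Rightarrow> nat \<times> nat" where
  "shift_block s x = (fst x, snd x + s)"

text \<open>A shift by \<open>s\<close> blocks in both indices preserves \<open>a - b\<close>, and
  what it pushes off the grid lies in the first \<open>s\<close> block rows or columns, where
  \<open>S\<close> is zero.\<close>

lemma block_diag_sum_shift:
  assumes zero: "\<And>a b. a \<le> L \<Longrightarrow> b \<le> L \<Longrightarrow> a < s \<or> b < s \<Longrightarrow> S (i, a) (j, b) = 0"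
    and ij: "i \<le> m" "j \<le> m"
  shows "block_diag_sum L (\<lambda>x y. if shift_block s x \<in> block_grid m L \<and> shift_block s y \<in> block_grid m L
            then S (shift_block s x) (shift_block s y) else 0) l i j
       = block_diag_sum L S l i j"
proof -
  let ?g = "\<lambda>(a, b). if int a - int b = l then S (i, a) (j, b) else 0"
  let ?T = "{(a, b). a \<le> L \<and> b \<le> L \<and> a + s \<le> L \<and> b + s \<le> L}"
  have T: "?T \<subseteq> {..L} \<times> {..L}" by auto
  have "block_diag_sum L (\<lambda>x y. if shift_block s x \<in> block_grid m L \<and> shift_block s y \<in> block_grid m L
            then S (shift_block s x) (shift_block s y) else 0) l i j
     = (\<Sum>(a, b)\<in>{..L} \<times> {..L}. if a + s \<le> L \<and> b + s \<le> L then ?g (a + s, b + s) else 0)"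
    unfolding block_diag_sum_def sum.cartesian_product using ij
    by (intro sum.cong refl) (auto simp: shift_block_def)
  also have "\<dots> = (\<Sum>(a, b)\<in>?T. ?g (a + s, b + s))"
    by (rule sum.mono_neutral_cong_right) (auto simp: split_beta)
  also have "\<dots> = sum ?g ((\<lambda>(a, b). (a + s, b + s)) ` ?T)"
    by (subst sum.reindex) (auto simp: inj_on_def o_def split_beta)
  also have "\<dots> = sum ?g ({..L} \<times> {..L})"
  proof (intro sum.mono_neutral_left ballI)
    fix z assume z: "z \<in> {..L} \<times> {..L} - (\<lambda>(a, b). (a + s, b + s)) ` ?T"
    obtain a b where ab: "z = (a, b)" by force
    have "a < s \<or> b < s"
    proof (rule ccontr)
      assume "\<not> (a < s \<or> b < s)"
      then have "z = (\<lambda>(a, b). (a + s, b + s)) (a - s, b - s)" "(a - s, b - s) \<in> ?T"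
        using z ab by auto
      then show False using z by blast
    qed
    then show "?g z = 0" using z ab zero by auto
  qed auto
  also have "\<dots> = block_diag_sum L S l i j"
    by (simp add: block_diag_sum_def sum.cartesian_product)
  finally show ?thesis .
qed

lemma block_diag_sum_add:
  "block_diag_sum L (\<lambda>x y. G x y + H x y) l i j = block_diag_sum L G l i j + block_diag_sum L H l i j"
proof -
  have "(if P then g + h else 0) = (if P then g else 0) + (if P then h else (0::complex))" for P g h
    by simp
  then show ?thesis by (simp add: block_diag_sum_def sum.distrib)
qed

text \<open>The second conjunct carries the invertibility of the factor's corner over to the degree
  argument.\<close>

lemma gram_extremal:
  assumes "gram m L c A G0" "c > 0"
  shows "\<exists>q. gram m L c A (\<lambda>x y. \<Sum>k\<in>block_grid m 0. q k x * cnj (q k y))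
    \<and> (\<forall>u. (\<forall>j\<in>block_grid m 0. (\<Sum>k\<in>block_grid m 0. u k * cnj (q k j)) = 0) \<longrightarrow> (\<forall>k\<in>block_grid m 0. u k = 0))"
proof -
  let ?J = "block_grid m 0" and ?I = "block_grid m L"
  obtain G where G: "gram m L c A G" and max: "\<And>H. gram m L c A H \<Longrightarrow> corner_trace m H \<le> corner_trace m G"
    using gram_maximizer[OF assms(1)] by blast
  have psdG: "psd ?I G" "psd ?J (\<lambda>x y. G x y - delta c x y)"
    and diagG: "\<And>l i j. i \<le> m \<Longrightarrow> j \<le> m \<Longrightarrow> block_diag_sum L G l i j = A l i j"
    using G by (auto simp: gram_def)
  obtain q S where S: "psd ?I S"
    and dec: "\<And>x y. x \<in> ?I \<Longrightarrow> y \<in> ?I \<Longrightarrow> G x y = (\<Sum>k\<in>?J. q k x * cnj (q k y)) + S x y"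
    and S0: "\<forall>x\<in>?J. \<forall>y\<in>?I. S x y = 0 \<and> S y x = 0"
    and ker: "\<forall>u. (\<forall>j\<in>?J. (\<Sum>k\<in>?J. u k * cnj (q k j)) = 0) \<longrightarrow> (\<forall>k\<in>?J. u k = 0)"
    using block_elimination[OF finite_block_grid psdG(1) finite_block_grid block_grid_mono assms(2) psdG(2)]
    by blast
  define Q where "Q = (\<lambda>x y. \<Sum>k\<in>?J. q k x * cnj (q k y))"
  have dec': "G x y = Q x y + S x y" if "x \<in> ?I" "y \<in> ?I" for x y
    using dec[OF that] by (simp add: Q_def)
  \<comment> \<open>The induction removes the block rows and columns of \<open>S\<close> one after
    the other; at \<open>s = Suc L\<close> nothing of \<open>S\<close> is left on the grid.\<close>
  have vanish: "\<forall>i j a b. i \<le> m \<longrightarrow> j \<le> m \<longrightarrow> a \<le> L \<longrightarrow> b \<le> L \<longrightarrow> a < s \<or> b < s \<longrightarrow> S (i, a) (j, b) = 0"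
    if "s \<le> Suc L" for s
    using that
  proof (induction s)
    case 0
    then show ?case by simp
  next
    case (Suc s)
    let ?sh = "shift_block s"
    let ?S' = "\<lambda>x y. if ?sh x \<in> ?I \<and> ?sh y \<in> ?I then S (?sh x) (?sh y) else 0"
    have S': "psd ?I ?S'"
      by (rule psd_restrict_reindex[OF S]) (auto simp: inj_on_def shift_block_def prod_eq_iff)
    have "gram m L c A (\<lambda>x y. Q x y + ?S' x y)"
      unfolding gram_def
    proof (intro conjI allI impI)
      show "psd ?I (\<lambda>x y. Q x y + ?S' x y)"
        unfolding Q_def by (intro psd_add psd_outer S')
      \<comment> \<open>On the corner \<open>S\<close> is zero, hence \<open>Q\<close> equals
        \<open>G\<close> there and inherits its lower bound.\<close>
      have "psd ?J (\<lambda>x y. Q x y - delta c x y)"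
      proof (subst psd_cong)
        fix x y assume xy: "x \<in> ?J" "y \<in> ?J"
        then have xy': "x \<in> ?I" "y \<in> ?I" using block_grid_mono[of m L] by auto
        show "Q x y - delta c x y = G x y - delta c x y"
          using dec'[OF xy'] S0 xy xy' by simp
      qed (rule psdG(2))
      moreover have "psd ?J ?S'" by (rule psd_subset[OF S' finite_block_grid block_grid_mono])
      ultimately have "psd ?J (\<lambda>x y. (Q x y - delta c x y) + ?S' x y)" by (rule psd_add)
      then show "psd ?J (\<lambda>x y. Q x y + ?S' x y - delta c x y)"
        by (simp only: add_diff_eq add.commute diff_add_eq)
    next
      fix l i j assume ij: "i \<le> m" "j \<le> m"
      have "block_diag_sum L ?S' l i j = block_diag_sum L S l i j"
        using Suc ij by (subst block_diag_sum_shift) auto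
      then have "block_diag_sum L (\<lambda>x y. Q x y + ?S' x y) l i j = block_diag_sum L (\<lambda>x y. Q x y + S x y) l i j"
        by (simp only: block_diag_sum_add)
      also have "\<dots> = block_diag_sum L G l i j"
        by (rule block_diag_sum_cong) (simp add: dec' ij)
      finally show "block_diag_sum L (\<lambda>x y. Q x y + ?S' x y) l i j = A l i j"
        using diagG ij by simp
    qed
    \<comment> \<open>Shifting \<open>S\<close> up by \<open>s\<close> blocks adds its \<open>s\<close>-th diagonal block to the corner.\<close>
    from max[OF this] have "(\<Sum>i\<le>m. Re (S (i, s) (i, s))) \<le> 0"
      using S0 Suc.prems by (simp add: corner_trace_def shift_block_def dec' sum.distrib)
    moreover have nn: "\<forall>i\<in>{..m}. 0 \<le> Re (S (i, s) (i, s))"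
      using psd_diag(2)[OF S] Suc.prems by simp
    ultimately have "\<forall>i\<in>{..m}. Re (S (i, s) (i, s)) = 0"
      by (metis (no_types, lifting) finite_atMost order_antisym sum_nonneg sum_nonneg_eq_0_iff)
    then have "S (i, s) (i, s) = 0" if "i \<le> m" for i
      using psd_diag(1)[OF S finite_block_grid, of "(i, s)"] that Suc.prems by auto
    then have "S (i, s) (j, b) = 0" "S (j, b) (i, s) = 0" if "i \<le> m" "j \<le> m" "b \<le> L" for i j b
      using psd_zero_diag[OF S finite_block_grid, of "(i, s)" "(j, b)"] that Suc.prems by auto
    then show ?case
      using Suc by (auto simp: less_Suc_eq)
  qed
  have "gram m L c A Q"
  proof (subst gram_cong[where H = G])
    fix x y assume "x \<in> ?I" "y \<in> ?I"
    then show "Q x y = G x y"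
      using dec'[of x y] vanish[of "Suc L"] by (cases x; cases y) auto
  qed (rule G)
  then show ?thesis
    using ker unfolding Q_def by blast
qed

text \<open>Descending induction on \<open>a\<close>. Once the coefficients of index above
  \<open>a\<close> vanish, the block diagonal \<open>a\<close> consists of the single product of the
  blocks \<open>a\<close> and \<open>0\<close> of the factor. For \<open>a > d\<close> it is zero,
  and invertibility of block \<open>0\<close> removes block \<open>a\<close>.\<close>

lemma gram_factor_degree:
  assumes gram: "gram m L c A (\<lambda>x y. \<Sum>k\<in>block_grid m 0. q k x * cnj (q k y))"
    and ker: "\<And>u. (\<And>j. j \<in> block_grid m 0 \<Longrightarrow> (\<Sum>k\<in>block_grid m 0. u k * cnj (q k j)) = 0) \<Longrightarrow>
      (\<forall>k\<in>block_grid m 0. u k = 0)"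
    and A: "\<And>l i j. l > int d \<Longrightarrow> A l i j = 0"
    and "k \<in> block_grid m 0" "i \<le> m" "d < a" "a \<le> L"
  shows "q k (i, a) = 0"
  using assms(4-)
proof (induction "L - a" arbitrary: a i k rule: less_induct)
  case less
  let ?J = "block_grid m 0" and ?Q = "\<lambda>x y. \<Sum>k\<in>block_grid m 0. q k x * cnj (q k y)"
  have van: "?Q (i, b) y = 0" if "a < b" "b \<le> L" for b y
    using that less by (intro sum.neutral) auto
  have "(\<Sum>k\<in>?J. q k (i, a) * cnj (q k j)) = 0" if "j \<in> ?J" for j
  proof -
    obtain j' where j: "j = (j', 0)" "j' \<le> m" using \<open>j \<in> ?J\<close> by (auto simp: block_grid_def)
    have "0 = A (int a) i j'" using A less by simp
    also have "\<dots> = block_diag_sum L ?Q (int a) i j'"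
      using gram less j by (simp add: gram_def)
    also have "\<dots> = (\<Sum>a'\<le>L. \<Sum>b\<le>L. if a' = a \<and> b = 0 then ?Q (i, a') (j', b) else 0)"
      unfolding block_diag_sum_def
    proof (intro sum.cong refl)
      fix a' b assume "a' \<in> {..L}" "b \<in> {..L}"
      then show "(if int a' - int b = int a then ?Q (i, a') (j', b) else 0)
          = (if a' = a \<and> b = 0 then ?Q (i, a') (j', b) else 0)"
        using van[of a' "(j', b)"] by (cases "a < a'") auto
    qed
    also have "\<dots> = (\<Sum>a'\<le>L. if a' = a then ?Q (i, a') (j', 0) else 0)"
      by (intro sum.cong refl) (simp add: sum.delta)
    also have "\<dots> = ?Q (i, a) j"
      using less by (simp add: j)
    finally show ?thesis by simp
  qed
  from ker[OF this] less show ?case by blast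
qed

section \<open>Trigonometric polynomials on the torus\<close>

definition tpoly :: "(int \<Rightarrow> int \<Rightarrow> complex) \<Rightarrow> nat \<Rightarrow> nat \<Rightarrow> complex \<Rightarrow> complex \<Rightarrow> complex" where
  "tpoly r n d z1 z2 =
     (\<Sum>k\<in>{- int n..int n}. \<Sum>l\<in>{- int d..int d}. r k l * z1 powi k * z2 powi l)"

definition supp_le :: "(int \<Rightarrow> int \<Rightarrow> complex) \<Rightarrow> nat \<Rightarrow> nat \<Rightarrow> bool" where
  "supp_le r n d \<longleftrightarrow> (\<forall>k l. \<bar>k\<bar> > int n \<or> \<bar>l\<bar> > int d \<longrightarrow> r k l = 0)"

definition unity_root :: "nat \<Rightarrow> nat \<Rightarrow> complex" where
  "unity_root K s = cis (2 * pi * s / K)"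

lemma norm_unity_root [simp]: "cmod (unity_root K s) = 1"
  by (simp add: unity_root_def)

lemma norm_powi_1: "cmod z = 1 \<Longrightarrow> cmod (z powi k) = 1"
  by (simp add: norm_power_int)

lemma cnj_powi: "cmod z = 1 \<Longrightarrow> cnj (z powi k) = z powi (- k)"
proof -
  assume z: "cmod z = 1"
  then have "z * cnj z = 1" by (simp add: complex_norm_square[symmetric])
  then have "cnj z = inverse z" by (metis inverse_unique)
  then show ?thesis by (simp add: power_int_minus power_int_inverse)
qed

lemma powi_diff_unit:
  assumes "cmod z = 1"
  shows "z powi (int i - int j) = z ^ i * cnj (z ^ j)"
proof -
  have "z \<noteq> 0" using assms by auto
  then have "z powi (int i - int j) = z powi int i * z powi (- int j)"
    by (simp add: power_int_add flip: diff_conv_add_uminus)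
       (simp add: power_int_diff power_int_minus field_simps)
  then show ?thesis using cnj_powi[OF assms, of "int j"] by simp
qed

text \<open>A geometric sum; the bound on \<open>e\<close> leaves \<open>0\<close> as the only
  multiple of \<open>K\<close> in range.\<close>

lemma sum_unity_root:
  assumes "\<bar>e\<bar> < int K"
  shows "(\<Sum>s<K. unity_root K s powi e) = (if e = 0 then of_nat K else 0)"
proof (cases "e = 0")
  case False
  define w where "w = cis (2 * pi * (of_int e / of_nat K))"
  have K: "K > 0" using assms by auto
  have "unity_root K s powi e = w ^ s" for s
    unfolding unity_root_def w_def
    unfolding cis_power_int Complex.DeMoivre
    by (rule arg_cong[of _ _ cis]) (simp add: mult_ac)
  moreover have "w \<noteq> 1"
  proof
    assume "w = 1"
    then have "cos (2 * pi * (of_int e / of_nat K)) = 1"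
      by (simp add: w_def complex_eq_iff)
    then obtain x :: int where x: "2 * pi * (of_int e / of_nat K) = of_int x * 2 * pi"
      by (auto simp: cos_one_2pi_int)
    then have "(2 * pi) * (of_int e / of_nat K) = (2 * pi) * of_int x" by (simp only: mult_ac)
    then have "of_int e / of_nat K = (of_int x :: real)"
      unfolding mult_cancel_left by simp
    then have "of_int e = (of_int (x * int K) :: real)" using K by (simp add: field_simps)
    then have "e = x * int K" by linarith
    then have "int K dvd e" by simp
    then show False using dvd_imp_le_int[of e "int K"] False assms by simp
  qed
  moreover have "w ^ K = 1"
  proof -
    have "w ^ K = cis (2 * pi * of_int e)" using K by (simp add: w_def Complex.DeMoivre)
    then show ?thesis by simp
  qed
  ultimately show ?thesis
    using False by (simp add: geometric_sum)
qed simp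

text \<open>Discrete Fourier inversion. The bounds on \<open>K\<close> exclude aliasing: differences
  of exponents stay below \<open>K\<close> in modulus.\<close>

lemma tpoly_coeff:
  assumes "supp_le r n d" "\<bar>k\<bar> + int n < int K" "\<bar>l\<bar> + int d < int K"
  shows "(\<Sum>s<K. \<Sum>t<K. tpoly r n d (unity_root K s) (unity_root K t)
            * unity_root K s powi (- k) * unity_root K t powi (- l)) = (of_nat K)\<^sup>2 * r k l"
proof -
  let ?w = "unity_root K"
  let ?A = "{- int n..int n}" and ?B = "{- int d..int d}"
  have nz: "?w s \<noteq> 0" for s
    by (metis norm_unity_root norm_zero zero_neq_one)
  have "(\<Sum>s<K. \<Sum>t<K. tpoly r n d (?w s) (?w t) * ?w s powi (- k) * ?w t powi (- l))
     = (\<Sum>s<K. \<Sum>t<K. \<Sum>k'\<in>?A. \<Sum>l'\<in>?B. r k' l' * ?w s powi (k' - k) * ?w t powi (l' - l))"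
    unfolding tpoly_def sum_distrib_right
    by (intro sum.cong refl) (simp add: power_int_diff power_int_minus nz divide_inverse)
  also have "\<dots> = (\<Sum>s<K. \<Sum>k'\<in>?A. \<Sum>t<K. \<Sum>l'\<in>?B. r k' l' * ?w s powi (k' - k) * ?w t powi (l' - l))"
    by (rule sum.cong[OF refl], rule sum.swap)
  also have "\<dots> = (\<Sum>k'\<in>?A. \<Sum>s<K. \<Sum>t<K. \<Sum>l'\<in>?B. r k' l' * ?w s powi (k' - k) * ?w t powi (l' - l))"
    by (rule sum.swap)
  also have "\<dots> = (\<Sum>k'\<in>?A. \<Sum>s<K. \<Sum>l'\<in>?B. \<Sum>t<K. r k' l' * ?w s powi (k' - k) * ?w t powi (l' - l))"
    by (rule sum.cong[OF refl], rule sum.cong[OF refl], rule sum.swap)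
  also have "\<dots> = (\<Sum>k'\<in>?A. \<Sum>l'\<in>?B. \<Sum>s<K. \<Sum>t<K. r k' l' * ?w s powi (k' - k) * ?w t powi (l' - l))"
    by (rule sum.cong[OF refl], rule sum.swap)
  also have "\<dots> = (\<Sum>k'\<in>?A. \<Sum>l'\<in>?B. r k' l' * ((\<Sum>s<K. ?w s powi (k' - k)) * (\<Sum>t<K. ?w t powi (l' - l))))"
    unfolding sum_product by (simp only: sum_distrib_left mult.assoc)
  also have "\<dots> = (\<Sum>k'\<in>?A. \<Sum>l'\<in>?B. if k' = k \<and> l' = l then r k' l' * (of_nat K)\<^sup>2 else 0)"
  proof (intro sum.cong refl)
    fix k' l' assume "k' \<in> ?A" "l' \<in> ?B"
    then have "\<bar>k' - k\<bar> < int K" "\<bar>l' - l\<bar> < int K" using assms by auto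
    then show "r k' l' * ((\<Sum>s<K. ?w s powi (k' - k)) * (\<Sum>t<K. ?w t powi (l' - l)))
        = (if k' = k \<and> l' = l then r k' l' * (of_nat K)\<^sup>2 else 0)"
      by (simp add: sum_unity_root power2_eq_square)
  qed
  also have "\<dots> = (\<Sum>k'\<in>?A. if k' = k then \<Sum>l'\<in>?B. if l' = l then r k' l' * (of_nat K)\<^sup>2 else 0 else 0)"
    by (intro sum.cong refl) auto
  also have "\<dots> = (of_nat K)\<^sup>2 * r k l"
    using assms(1) by (auto simp: supp_le_def not_le abs_le_iff)
  finally show ?thesis .
qed

text \<open>Conjugating the inversion formula leaves the real values unchanged and flips the signs
  of both exponents.\<close>

lemma tpoly_real_imp_hermitian:
  assumes "supp_le r n d" "\<And>z1 z2. cmod z1 = 1 \<Longrightarrow> cmod z2 = 1 \<Longrightarrow> tpoly r n d z1 z2 \<in> \<real>"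
  shows "cnj (r k l) = r (- k) (- l)"
proof (cases "\<bar>k\<bar> \<le> int n \<and> \<bar>l\<bar> \<le> int d")
  case True
  define K where "K = 2 * n + 2 * d + 1"
  let ?w = "unity_root K"
  have c: "\<bar>k'\<bar> + int n < int K" "\<bar>l'\<bar> + int d < int K" if "\<bar>k'\<bar> = \<bar>k\<bar>" "\<bar>l'\<bar> = \<bar>l\<bar>" for k' l'
    using True that by (auto simp: K_def)
  have "(of_nat K)\<^sup>2 * cnj (r k l) = cnj ((of_nat K)\<^sup>2 * r k l)" by simp
  also have "\<dots> = (\<Sum>s<K. \<Sum>t<K. cnj (tpoly r n d (?w s) (?w t)) * cnj (?w s powi (- k)) * cnj (?w t powi (- l)))"
    unfolding tpoly_coeff[OF assms(1) c[OF refl refl], symmetric] by simp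
  also have "\<dots> = (\<Sum>s<K. \<Sum>t<K. tpoly r n d (?w s) (?w t) * ?w s powi (- (- k)) * ?w t powi (- (- l)))"
    using assms(2) by (intro sum.cong refl) (simp add: cnj_powi Reals_cnj_iff del: complex_cnj_power_int)
  also have "\<dots> = (of_nat K)\<^sup>2 * r (- k) (- l)"
    by (rule tpoly_coeff[OF assms(1) c]) auto
  finally have "(of_nat K)\<^sup>2 * cnj (r k l) = (of_nat K)\<^sup>2 * r (- k) (- l)" .
  moreover have "(of_nat K :: complex) \<noteq> 0"
    unfolding of_nat_eq_0_iff by (simp add: K_def)
  ultimately show ?thesis by simp
qed (use assms(1) in \<open>auto simp: supp_le_def\<close>)

section \<open>Toeplitz matrices of nonnegative symbols\<close>

text \<open>Two-level Toeplitz: a block Toeplitz matrix whose blocks are Toeplitz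
  themselves.\<close>

definition toeplitz :: "(int \<Rightarrow> int \<Rightarrow> complex) \<Rightarrow> nat \<times> nat \<Rightarrow> nat \<times> nat \<Rightarrow> complex" where
  "toeplitz r x y = r (int (fst x) - int (fst y)) (int (snd x) - int (snd y))"

text \<open>The form at \<open>v\<close> is a mean over torus points of the symbol times the squared
  modulus of the polynomial with coefficients \<open>v\<close>.\<close>

lemma psd_toeplitz:
  assumes supp: "supp_le r n d" and herm: "\<And>k l. cnj (r k l) = r (- k) (- l)"
    and pos: "\<And>z1 z2. cmod z1 = 1 \<Longrightarrow> cmod z2 = 1 \<Longrightarrow> 0 \<le> Re (tpoly r n d z1 z2)"
  shows "psd (block_grid m L) (toeplitz r)"
proof -
  \<comment> \<open>Index differences reach \<open>m\<close> and \<open>L\<close>, and the exponents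
    of the symbol \<open>n\<close> and \<open>d\<close>; \<open>K\<close> exceeds the sums required
    for inversion.\<close>
  define K where "K = n + m + d + L + 1"
  let ?w = "unity_root K" and ?I = "block_grid m L"
  have "0 \<le> Re (herm_form ?I (toeplitz r) v)" for v
  proof -
    define e where "e s t x = ?w s ^ fst x * ?w t ^ snd x" for s t and x :: "nat \<times> nat"
    define f where "f s t = (\<Sum>x\<in>?I. v x * e s t x)" for s t
    let ?E = "\<lambda>s t. tpoly r n d (?w s) (?w t)"
    \<comment> \<open>Averaging over the \<open>K\<close>-th roots of unity replaces integration over the torus.\<close>
    have entry: "(of_nat K)\<^sup>2 * toeplitz r x y = (\<Sum>s<K. \<Sum>t<K. ?E s t * (cnj (e s t x) * e s t y))"
      if "x \<in> ?I" "y \<in> ?I" for x y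
    proof -
      have "(of_nat K)\<^sup>2 * toeplitz r x y =
        (\<Sum>s<K. \<Sum>t<K. ?E s t * ?w s powi (- (int (fst x) - int (fst y))) * ?w t powi (- (int (snd x) - int (snd y))))"
        unfolding toeplitz_def using that
        by (intro tpoly_coeff[OF supp, symmetric]) (auto simp: K_def block_grid_def)
      then show ?thesis
        by (simp add: e_def powi_diff_unit mult_ac)
    qed
    have "of_real ((real K)\<^sup>2) * herm_form ?I (toeplitz r) v
        = (\<Sum>x\<in>?I. \<Sum>y\<in>?I. cnj (v x) * ((of_nat K)\<^sup>2 * toeplitz r x y) * v y)"
      by (simp add: herm_form_def sum_distrib_left mult_ac)
    also have "\<dots> = (\<Sum>x\<in>?I. \<Sum>y\<in>?I. \<Sum>(s, t)\<in>{..<K} \<times> {..<K}. ?E s t * (cnj (v x * e s t x) * (v y * e s t y)))"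
    proof (intro sum.cong refl)
      fix x y assume "x \<in> ?I" "y \<in> ?I"
      then show "cnj (v x) * ((of_nat K)\<^sup>2 * toeplitz r x y) * v y
          = (\<Sum>(s, t)\<in>{..<K} \<times> {..<K}. ?E s t * (cnj (v x * e s t x) * (v y * e s t y)))"
        unfolding entry[OF \<open>x \<in> ?I\<close> \<open>y \<in> ?I\<close>]
        by (simp add: sum.cartesian_product sum_distrib_left sum_distrib_right split_beta mult_ac)
    qed
    also have "\<dots> = (\<Sum>x\<in>?I. \<Sum>(s, t)\<in>{..<K} \<times> {..<K}. \<Sum>y\<in>?I. ?E s t * (cnj (v x * e s t x) * (v y * e s t y)))"
      unfolding split_beta by (rule sum.cong[OF refl], rule sum.swap)
    also have "\<dots> = (\<Sum>(s, t)\<in>{..<K} \<times> {..<K}. \<Sum>x\<in>?I. \<Sum>y\<in>?I. ?E s t * (cnj (v x * e s t x) * (v y * e s t y)))"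
      unfolding split_beta by (rule sum.swap)
    also have "\<dots> = (\<Sum>(s, t)\<in>{..<K} \<times> {..<K}. ?E s t * of_real ((cmod (f s t))\<^sup>2))"
    proof (intro sum.cong refl, clarify)
      fix s t
      have "(\<Sum>x\<in>?I. \<Sum>y\<in>?I. ?E s t * (cnj (v x * e s t x) * (v y * e s t y))) = ?E s t * (cnj (f s t) * f s t)"
        unfolding f_def cnj_sum sum_product by (simp only: sum_distrib_left)
      also have "cnj (f s t) * f s t = of_real ((cmod (f s t))\<^sup>2)"
        by (simp only: complex_norm_square mult.commute)
      finally show "(\<Sum>x\<in>?I. \<Sum>y\<in>?I. ?E s t * (cnj (v x * e s t x) * (v y * e s t y))) = ?E s t * of_real ((cmod (f s t))\<^sup>2)" .
    qed
    finally have "Re (of_real ((real K)\<^sup>2) * herm_form ?I (toeplitz r) v)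
        = Re (\<Sum>(s, t)\<in>{..<K} \<times> {..<K}. ?E s t * of_real ((cmod (f s t))\<^sup>2))"
      by (rule arg_cong)
    then have "(real K)\<^sup>2 * Re (herm_form ?I (toeplitz r) v)
        = (\<Sum>(s, t)\<in>{..<K} \<times> {..<K}. Re (?E s t) * (cmod (f s t))\<^sup>2)"
      by (simp add: split_beta del: of_real_power)
    also have "\<dots> \<ge> 0"
      using pos by (auto intro!: sum_nonneg mult_nonneg_nonneg)
    finally show ?thesis
      by (simp add: zero_le_mult_iff K_def)
  qed
  then show ?thesis
    using herm by (simp add: psd_def toeplitz_def)
qed

lemma tpoly_delta: "tpoly (\<lambda>k l. if k = 0 \<and> l = 0 then of_real c else 0) n d z1 z2 = of_real c"
proof -
  have "tpoly (\<lambda>k l. if k = 0 \<and> l = 0 then of_real c else 0) n d z1 z2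
    = (\<Sum>k\<in>{- int n..int n}. \<Sum>l\<in>{- int d..int d}. if k = 0 \<and> l = 0 then of_real c else 0)"
    unfolding tpoly_def by (intro sum.cong refl) auto
  also have "\<dots> = (\<Sum>k\<in>{- int n..int n}. if k = 0 then of_real c else 0)"
    by (intro sum.cong refl) auto
  finally show ?thesis by simp
qed

lemma tpoly_diff: "tpoly (\<lambda>k l. r k l - s k l) n d z1 z2 = tpoly r n d z1 z2 - tpoly s n d z1 z2"
  by (simp add: tpoly_def sum_subtractf algebra_simps)

lemma tpoly_add: "tpoly (\<lambda>k l. r k l + s k l) n d z1 z2 = tpoly r n d z1 z2 + tpoly s n d z1 z2"
  by (simp add: tpoly_def sum.distrib algebra_simps)

lemma tpoly_cmult: "tpoly (\<lambda>k l. a * r k l) n d z1 z2 = a * tpoly r n d z1 z2"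
  by (simp add: tpoly_def sum_distrib_left algebra_simps)

text \<open>Lowering the constant coefficient by \<open>c\<close> lowers the symbol by
  \<open>c\<close> and the matrix by \<open>c\<close> times the identity.\<close>

lemma psd_toeplitz_delta:
  assumes supp: "supp_le r n d" and herm: "\<And>k l. cnj (r k l) = r (- k) (- l)"
    and pos: "\<And>z1 z2. cmod z1 = 1 \<Longrightarrow> cmod z2 = 1 \<Longrightarrow> c \<le> Re (tpoly r n d z1 z2)"
  shows "psd (block_grid m L) (\<lambda>x y. toeplitz r x y - delta c x y)"
proof -
  let ?r = "\<lambda>k l. r k l - (if k = 0 \<and> l = 0 then of_real c else 0)"
  have "psd (block_grid m L) (toeplitz ?r)"
  proof (rule psd_toeplitz)
    show "supp_le ?r n d" using supp by (auto simp: supp_le_def)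
    show "cnj (?r k l) = ?r (- k) (- l)" for k l using herm by simp
    show "0 \<le> Re (tpoly ?r n d z1 z2)" if "cmod z1 = 1" "cmod z2 = 1" for z1 z2
      using pos[OF that] by (simp add: tpoly_diff tpoly_delta)
  qed
  moreover have "toeplitz ?r = (\<lambda>x y. toeplitz r x y - delta c x y)"
    by (intro ext) (auto simp: toeplitz_def delta_def prod_eq_iff)
  ultimately show ?thesis by simp
qed

section \<open>Positivity of weighted symbols\<close>

lemma sum_int_symmetric:
  fixes g :: "nat \<Rightarrow> real"
  shows "(\<Sum>k\<in>{- int n..int n}. g (nat \<bar>k\<bar>)) = 2 * (\<Sum>i\<le>n. g i) - g 0"
proof (induction n)
  case (Suc n)
  have "{- int (Suc n)..int (Suc n)} = insert (- int (Suc n)) (insert (int (Suc n)) {- int n..int n})"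
    by auto
  then have "(\<Sum>k\<in>{- int (Suc n)..int (Suc n)}. g (nat \<bar>k\<bar>))
     = g (nat \<bar>- int (Suc n)\<bar>) + (g (nat \<bar>int (Suc n)\<bar>) + (\<Sum>k\<in>{- int n..int n}. g (nat \<bar>k\<bar>)))"
    by (simp only:) (subst sum.insert; simp)+
  moreover have "nat \<bar>- int (Suc n)\<bar> = Suc n" "nat \<bar>int (Suc n)\<bar> = Suc n" by auto
  ultimately show ?case using Suc by simp
qed simp

lemma sum_abs_diff_nat:
  assumes "h \<le> n"
  shows "2 * (\<Sum>i\<le>n. \<bar>real i - real h\<bar>) = real h * (real h + 1) + (real n - real h) * (real n - real h + 1)"
  using assms
proof (induction n rule: dec_induct)
  case base
  have "2 * (\<Sum>i\<le>j. real h - real i) = 2 * (real j + 1) * real h - real j * (real j + 1)" for j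
    by (induction j) (simp_all add: algebra_simps)
  moreover have "(\<Sum>i\<le>h. \<bar>real i - real h\<bar>) = (\<Sum>i\<le>h. real h - real i)"
    by (intro sum.cong) auto
  moreover note calculation(1)[of h]
  ultimately show ?case by (simp add: algebra_simps)
next
  case (step n)
  then show ?case by (simp add: algebra_simps)
qed

text \<open>The source of the factor \<open>n1 * (n1 + 1) / 2\<close> in the gap condition. The
  centre \<open>(n + 1) div 2\<close> is the median of the moduli \<open>0, 1, 1, ..., n, n\<close>,
  and therefore minimises the sum.\<close>

lemma sum_abs_median:
  "(\<Sum>k\<in>{- int n..int n}. \<bar>\<bar>real_of_int k\<bar> - real ((n + 1) div 2)\<bar>) = real n * (real n + 1) / 2"
proof -
  define h where "h = (n + 1) div 2"
  have "(\<Sum>k\<in>{- int n..int n}. \<bar>\<bar>real_of_int k\<bar> - real h\<bar>)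
      = (\<Sum>k\<in>{- int n..int n}. \<bar>real (nat \<bar>k\<bar>) - real h\<bar>)"
    by (intro sum.cong refl) simp
  also have "\<dots> = real h * (real h + 1) + (real n - real h) * (real n - real h + 1) - real h"
    unfolding sum_int_symmetric[where g = "\<lambda>i. \<bar>real i - real h\<bar>"]
    by (subst sum_abs_diff_nat) (auto simp: h_def)
  also have "\<dots> = real n * (real n + 1) / 2"
  proof (cases "even n")
    case True
    then obtain j where "n = 2 * j" by blast
    then have "n = 2 * j" "h = j" by (auto simp: h_def)
    then show ?thesis by (simp add: algebra_simps)
  next
    case False
    then obtain j where "n = 2 * j + 1" by (elim oddE)
    then have "n = 2 * j + 1" "h = j + 1" by (auto simp: h_def)
    then show ?thesis by (simp add: algebra_simps)
  qed
  finally show ?thesis by (simp add: h_def)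
qed

lemma Re_of_real_mult: "Re (of_real a * w) = a * Re w"
  by simp

text \<open>With \<open>h\<close> the median and \<open>w\<close> the weight
  \<open>m + 1 - \<bar>k\<bar>\<close>, the identity
  \<open>N / w = 1 + (\<bar>k\<bar> - h) / w\<close> splits \<open>N\<close> times the weighted
  symbol into the original one and an error \<open>E\<close>.\<close>

lemma fejer_weighted_lower_bound:
  fixes p :: "int \<Rightarrow> complex"
  assumes "n < m" "cmod z = 1" "C \<ge> 0"
    and C: "\<And>k. k \<in> {- int n..int n} \<Longrightarrow> cmod (p k) \<le> C"
    and pos: "\<epsilon> \<le> Re (\<Sum>k\<in>{- int n..int n}. p k * z powi k)"
  defines "N \<equiv> real m + 1 - real ((n + 1) div 2)"
  shows "\<epsilon> - real n * (real n + 1) * C / (2 * (real m - real n))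
    \<le> N * Re (\<Sum>k\<in>{- int n..int n}. p k / of_real (real m + 1 - \<bar>real_of_int k\<bar>) * z powi k)"
proof -
  let ?A = "{- int n..int n}"
  define h where "h = (n + 1) div 2"
  define E where "E = (\<Sum>k\<in>?A. p k * of_real ((\<bar>real_of_int k\<bar> - real h) / (real m + 1 - \<bar>real_of_int k\<bar>)) * z powi k)"
  \<comment> \<open>All weights are at least \<open>m - n\<close>, the quantity in which the gap
    condition is stated.\<close>
  have pk: "real m - real n \<le> real m + 1 - \<bar>real_of_int k\<bar>" "0 < real m - real n" if "k \<in> ?A" for k
    using that assms(1) by auto
  have "of_real N * (\<Sum>k\<in>?A. p k / of_real (real m + 1 - \<bar>real_of_int k\<bar>) * z powi k)
      = (\<Sum>k\<in>?A. p k * z powi k) + E"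
    unfolding E_def sum.distrib[symmetric] sum_distrib_left
  proof (intro sum.cong refl)
    fix k assume k: "k \<in> ?A"
    define w where "w = real m + 1 - \<bar>real_of_int k\<bar>"
    have w: "w \<noteq> 0" using pk[OF k] by (simp add: w_def)
    have "N / w = 1 + (\<bar>real_of_int k\<bar> - real h) / w"
      using w by (simp add: N_def h_def w_def field_simps)
    then have "complex_of_real N / of_real w = 1 + of_real ((\<bar>real_of_int k\<bar> - real h) / w)"
      by (metis of_real_1 of_real_add of_real_divide)
    moreover have "of_real N * (p k / of_real w * z powi k) = (of_real N / of_real w) * (p k * z powi k)"
      by simp
    ultimately show "of_real N * (p k / of_real (real m + 1 - \<bar>real_of_int k\<bar>) * z powi k)
        = p k * z powi k + p k * of_real ((\<bar>real_of_int k\<bar> - real h) / (real m + 1 - \<bar>real_of_int k\<bar>)) * z powi k"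
      unfolding w_def[symmetric] by (simp add: algebra_simps)
  qed
  from arg_cong[OF this, of Re]
  have "N * Re (\<Sum>k\<in>?A. p k / of_real (real m + 1 - \<bar>real_of_int k\<bar>) * z powi k)
      = Re (\<Sum>k\<in>?A. p k * z powi k) + Re E"
    by (simp only: Re_of_real_mult plus_complex.sel)
  moreover have "cmod E \<le> real n * (real n + 1) * C / (2 * (real m - real n))"
  proof -
    have "cmod E \<le> (\<Sum>k\<in>?A. \<bar>\<bar>real_of_int k\<bar> - real h\<bar> * (C / (real m - real n)))"
      unfolding E_def
    proof (intro sum_norm_le)
      fix k assume k: "k \<in> ?A"
      let ?w = "real m + 1 - \<bar>real_of_int k\<bar>"
      have w: "?w > 0" using pk[OF k] by linarith
      have "cmod (p k * of_real ((\<bar>real_of_int k\<bar> - real h) / ?w) * z powi k)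
          = cmod (p k) * (\<bar>\<bar>real_of_int k\<bar> - real h\<bar> / ?w)"
        using w by (simp add: norm_mult norm_powi_1[OF assms(2)] abs_divide del: of_real_divide of_real_diff)
      also have "\<dots> \<le> C * (\<bar>\<bar>real_of_int k\<bar> - real h\<bar> / (real m - real n))"
        using pk[OF k] C[OF k] assms(3) by (intro mult_mono divide_left_mono mult_pos_pos w) (auto simp: w less_imp_le)
      finally show "cmod (p k * of_real ((\<bar>real_of_int k\<bar> - real h) / ?w) * z powi k)
          \<le> \<bar>\<bar>real_of_int k\<bar> - real h\<bar> * (C / (real m - real n))" by (simp add: mult_ac)
    qed
    also have "\<dots> = real n * (real n + 1) / 2 * (C / (real m - real n))"
      unfolding sum_distrib_right[symmetric] h_def sum_abs_median ..
    finally show ?thesis by simp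
  qed
  moreover have "- cmod E \<le> Re E" using abs_Re_le_cmod[of E] by linarith
  ultimately show ?thesis using pos by linarith
qed

lemma tpoly_norm_le:
  assumes "cmod z1 = 1" "cmod z2 = 1"
  shows "cmod (tpoly r n d z1 z2) \<le> (\<Sum>k\<in>{- int n..int n}. \<Sum>l\<in>{- int d..int d}. cmod (r k l))"
  unfolding tpoly_def
  by (intro sum_norm_le) (simp add: norm_mult norm_powi_1 assms)

text \<open>The divisor is the number of entries on the diagonal \<open>l\<close> of a square matrix
  of size \<open>L + 1\<close>, so that the diagonal sums of the Toeplitz matrix give back
  \<open>s\<close>. Up to the factor \<open>L + 1\<close> these are reciprocals of the Fejer
  weights.\<close>

definition fejer :: "nat \<Rightarrow> (int \<Rightarrow> int \<Rightarrow> complex) \<Rightarrow> int \<Rightarrow> int \<Rightarrow> complex" where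
  "fejer L s k l = s k l / of_real (real L + 1 - \<bar>real_of_int l\<bar>)"

text \<open>As \<open>L\<close> grows, \<open>L + 1\<close> times the weighted symbol tends to the
  original one uniformly on the torus, so half of the lower bound \<open>\<eta>\<close> survives for
  a suitable \<open>L\<close>.\<close>

lemma fejer_positive:
  assumes supp: "supp_le s n d" and "\<eta> > 0"
    and pos: "\<And>z1 z2. cmod z1 = 1 \<Longrightarrow> cmod z2 = 1 \<Longrightarrow> \<eta> \<le> Re (tpoly s n d z1 z2)"
  shows "\<exists>L\<ge>d. \<exists>c>0. \<forall>z1 z2. cmod z1 = 1 \<longrightarrow> cmod z2 = 1 \<longrightarrow> c \<le> Re (tpoly (fejer L s) n d z1 z2)"
proof -
  let ?A = "{- int n..int n}" and ?B = "{- int d..int d}"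
  define B where "B = (\<Sum>k\<in>?A. \<Sum>l\<in>?B. cmod (s k l))"
  have B: "B \<ge> 0" by (auto simp: B_def intro!: sum_nonneg)
  \<comment> \<open>Chosen so that the relative coefficient error \<open>d / (L + 1 - d)\<close>,
    multiplied by the coefficient sum \<open>B\<close>, is at most
    \<open>\<eta> / 2\<close>.\<close>
  define L where "L = d + nat \<lceil>2 * real d * B / \<eta>\<rceil>"
  have dL: "d \<le> L" by (simp add: L_def)
  have "2 * real d * B / \<eta> \<le> real L - real d" by (simp add: L_def) linarith
  then have small: "real d / (real L + 1 - real d) * B \<le> \<eta> / 2"
    using assms(2) dL by (simp add: field_simps)
  have "\<eta> / (2 * (real L + 1)) \<le> Re (tpoly (fejer L s) n d z1 z2)"
    if z: "cmod z1 = 1" "cmod z2 = 1" for z1 z2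
  proof -
    define e where "e k l = (if \<bar>l\<bar> \<le> int d then s k l * of_real (\<bar>real_of_int l\<bar> / (real L + 1 - \<bar>real_of_int l\<bar>)) else 0)" for k l
    have "of_real (real L + 1) * fejer L s k l = s k l + e k l" for k l
    proof (cases "\<bar>l\<bar> \<le> int d")
      case True
      define w where "w = real L + 1 - \<bar>real_of_int l\<bar>"
      have w: "w \<noteq> 0" using True dL by (simp add: w_def)
      have "(real L + 1) / w = 1 + \<bar>real_of_int l\<bar> / w"
        using w by (simp add: w_def field_simps)
      then have "complex_of_real (real L + 1) / of_real w = 1 + of_real (\<bar>real_of_int l\<bar> / w)"
        by (metis of_real_1 of_real_add of_real_divide)
      moreover have "of_real (real L + 1) * (s k l / of_real w) = (of_real (real L + 1) / of_real w) * s k l"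
        by simp
      ultimately show ?thesis
        using True unfolding fejer_def e_def w_def[symmetric] by (simp add: algebra_simps)
    next
      case False
      then show ?thesis using supp by (simp add: fejer_def e_def supp_le_def)
    qed
    then have "of_real (real L + 1) * tpoly (fejer L s) n d z1 z2 = tpoly s n d z1 z2 + tpoly e n d z1 z2"
      unfolding tpoly_cmult[symmetric] tpoly_add[symmetric] by simp
    from arg_cong[OF this, of Re] have eq: "(real L + 1) * Re (tpoly (fejer L s) n d z1 z2) = Re (tpoly s n d z1 z2) + Re (tpoly e n d z1 z2)"
      by (simp only: Re_of_real_mult plus_complex.sel)
    have "cmod (tpoly e n d z1 z2) \<le> (\<Sum>k\<in>?A. \<Sum>l\<in>?B. cmod (e k l))"
      by (rule tpoly_norm_le[OF z])
    also have "\<dots> \<le> (\<Sum>k\<in>?A. \<Sum>l\<in>?B. real d / (real L + 1 - real d) * cmod (s k l))"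
    proof (intro sum_mono)
      fix k l assume "k \<in> ?A" "l \<in> ?B"
      then have l: "\<bar>l\<bar> \<le> int d" by auto
      then have l': "\<bar>real_of_int l\<bar> \<le> real d" by linarith
      have "\<bar>real_of_int l\<bar> / (real L + 1 - \<bar>real_of_int l\<bar>) \<le> real d / (real L + 1 - real d)"
        using l' dL by (intro frac_le) auto
      moreover have "cmod (e k l) = \<bar>real_of_int l\<bar> / (real L + 1 - \<bar>real_of_int l\<bar>) * cmod (s k l)"
        using l l' dL by (simp add: e_def norm_mult abs_divide del: of_real_divide of_real_diff)
      ultimately show "cmod (e k l) \<le> real d / (real L + 1 - real d) * cmod (s k l)"
        by (simp only: mult_right_mono norm_ge_zero)
    qed
    also have "\<dots> = real d / (real L + 1 - real d) * B"
      by (simp add: B_def sum_distrib_left)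
    finally have "cmod (tpoly e n d z1 z2) \<le> \<eta> / 2" using small by linarith
    then have "- (\<eta> / 2) \<le> Re (tpoly e n d z1 z2)"
      using abs_Re_le_cmod[of "tpoly e n d z1 z2"] by linarith
    then have "\<eta> / 2 \<le> (real L + 1) * Re (tpoly (fejer L s) n d z1 z2)"
      using eq pos[OF z] by linarith
    then show ?thesis by (simp add: field_simps)
  qed
  moreover have "\<eta> / (2 * (real L + 1)) > 0" using assms(2) by simp
  ultimately show ?thesis using dL by blast
qed

section \<open>Sums along matrix diagonals\<close>

lemma sum_diagonal:
  fixes c :: complex
  assumes "\<bar>l\<bar> \<le> int L"
  shows "(\<Sum>a\<le>L. \<Sum>b\<le>L. if int a - int b = l then c else 0) = of_real (real L + 1 - \<bar>real_of_int l\<bar>) * c"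
proof -
  let ?T = "{a. a \<le> L \<and> l \<le> int a \<and> int a \<le> int L + l}"
  have "(\<Sum>b\<le>L. if int a - int b = l then c else 0) = (if a \<in> ?T then c else 0)" if "a \<le> L" for a
  proof (cases "a \<in> ?T")
    case True
    then have "(\<Sum>b\<le>L. if int a - int b = l then c else 0) = (\<Sum>b\<le>L. if b = nat (int a - l) then c else 0)"
      by (intro sum.cong refl) auto
    also have "\<dots> = c" using True by (auto simp: sum.delta)
    finally show ?thesis using True by simp
  next
    case False
    then have "(\<Sum>b\<le>L. if int a - int b = l then c else 0) = 0"
      using that by (intro sum.neutral) auto
    then show ?thesis using False by (simp only: if_False)
  qed
  then have "(\<Sum>a\<le>L. \<Sum>b\<le>L. if int a - int b = l then c else 0) = (\<Sum>a\<le>L. if a \<in> ?T then c else 0)"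
    by (intro sum.cong) auto
  also have "\<dots> = (\<Sum>a\<in>?T. c)"
    by (rule sum.mono_neutral_cong_right) auto
  also have "\<dots> = of_nat (card ?T) * c" by simp
  \<comment> \<open>The rows that meet the diagonal \<open>l\<close> inside the matrix form an
    interval; \<open>nat\<close> truncates its lower end to \<open>0\<close> when \<open>l\<close>
    is negative.\<close>
  also have "?T = {nat l..nat (int L + min l 0)}" using assms by auto
  also have "of_nat (card {nat l..nat (int L + min l 0)}) = complex_of_real (real L + 1 - \<bar>real_of_int l\<bar>)"
  proof -
    have "int (card {nat l..nat (int L + min l 0)}) = int L + 1 - \<bar>l\<bar>"
      using assms by auto
    then have "real_of_int (int (card {nat l..nat (int L + min l 0)})) = real_of_int (int L + 1 - \<bar>l\<bar>)"
      by (rule arg_cong)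
    then have "real (card {nat l..nat (int L + min l 0)}) = real L + 1 - \<bar>real_of_int l\<bar>"
      by simp
    then show ?thesis by (metis of_real_of_nat_eq)
  qed
  finally show ?thesis .
qed

text \<open>Grouping by \<open>a - b\<close> turns a double sum into a Laurent polynomial; it is
  applied once in each variable.\<close>

lemma sum_collect_diagonals:
  fixes F :: "nat \<Rightarrow> nat \<Rightarrow> complex"
  shows "(\<Sum>a\<le>L. \<Sum>b\<le>L. F a b * g (int a - int b))
     = (\<Sum>l\<in>{- int L..int L}. (\<Sum>a\<le>L. \<Sum>b\<le>L. if int a - int b = l then F a b else 0) * g l)"
proof -
  have "(\<Sum>a\<le>L. \<Sum>b\<le>L. F a b * g (int a - int b))
     = (\<Sum>a\<le>L. \<Sum>b\<le>L. \<Sum>l\<in>{- int L..int L}. if int a - int b = l then F a b * g l else 0)"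
    by (intro sum.cong refl) (simp add: sum.delta')
  also have "\<dots> = (\<Sum>a\<le>L. \<Sum>l\<in>{- int L..int L}. \<Sum>b\<le>L. if int a - int b = l then F a b * g l else 0)"
    by (rule sum.cong[OF refl], rule sum.swap)
  also have "\<dots> = (\<Sum>l\<in>{- int L..int L}. \<Sum>a\<le>L. \<Sum>b\<le>L. if int a - int b = l then F a b * g l else 0)"
    by (rule sum.swap)
  also have "\<dots> = (\<Sum>l\<in>{- int L..int L}. (\<Sum>a\<le>L. \<Sum>b\<le>L. if int a - int b = l then F a b else 0) * g l)"
    unfolding sum_distrib_right by (intro sum.cong refl) auto
  finally show ?thesis .
qed

section \<open>Sums of squares\<close>

lemma tpoly_enlarge:
  assumes "supp_le r n d" "n \<le> m" "d \<le> L"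
  shows "tpoly r m L z1 z2 = tpoly r n d z1 z2"
proof -
  have "tpoly r m L z1 z2 = (\<Sum>k\<in>{- int m..int m}. \<Sum>l\<in>{- int d..int d}. r k l * z1 powi k * z2 powi l)"
    unfolding tpoly_def using assms
    by (intro sum.cong refl sum.mono_neutral_right) (auto simp: supp_le_def)
  also have "\<dots> = tpoly r n d z1 z2"
    unfolding tpoly_def using assms
    by (intro sum.mono_neutral_right) (auto simp: supp_le_def intro!: sum.neutral)
  finally show ?thesis .
qed

text \<open>Supplies the Gram matrix with which the maximisation starts.\<close>

lemma gram_toeplitz_fejer:
  assumes supp: "supp_le s n d" and herm: "\<And>k l. cnj (s k l) = s (- k) (- l)"
    and "d \<le> L" "c > 0"
    and pos: "\<And>z1 z2. cmod z1 = 1 \<Longrightarrow> cmod z2 = 1 \<Longrightarrow> c \<le> Re (tpoly (fejer L s) n d z1 z2)"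
  shows "gram m L c (\<lambda>l i j. s (int i - int j) l) (toeplitz (fejer L s))"
proof -
  have supp': "supp_le (fejer L s) n d"
    using supp by (auto simp: supp_le_def fejer_def)
  have herm': "cnj (fejer L s k l) = fejer L s (- k) (- l)" for k l
    using herm by (simp add: fejer_def)
  have "block_diag_sum L (toeplitz (fejer L s)) l i j = s (int i - int j) l" for l i j
  proof -
    let ?c = "fejer L s (int i - int j) l"
    have eq: "block_diag_sum L (toeplitz (fejer L s)) l i j
        = (\<Sum>a\<le>L. \<Sum>b\<le>L. if int a - int b = l then ?c else 0)"
      unfolding block_diag_sum_def toeplitz_def by (intro sum.cong refl) auto
    show ?thesis
    proof (cases "\<bar>l\<bar> \<le> int L")
      case True
      then have "complex_of_real (real L + 1 - \<bar>real_of_int l\<bar>) \<noteq> 0"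
        unfolding of_real_eq_0_iff by linarith
      then show ?thesis
        unfolding eq sum_diagonal[OF True] fejer_def by (simp del: of_real_diff of_real_add)
    next
      case False
      then have "s (int i - int j) l = 0" using supp assms(3) by (simp add: supp_le_def)
      moreover have "(\<Sum>a\<le>L. \<Sum>b\<le>L. if int a - int b = l then ?c else 0) = 0"
        using False by (intro sum.neutral ballI) auto
      ultimately show ?thesis using eq by simp
    qed
  qed
  moreover have "0 \<le> Re (tpoly (fejer L s) n d z1 z2)" if "cmod z1 = 1" "cmod z2 = 1" for z1 z2
    using pos[OF that] assms(4) by linarith
  ultimately show ?thesis
    unfolding gram_def
    using psd_toeplitz[OF supp' herm'] psd_toeplitz_delta[OF supp' herm' pos] by blast
qed

lemma sum_block_grid: "sum f (block_grid m L) = (\<Sum>i\<le>m. \<Sum>a\<le>L. f (i, a))"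
  by (simp add: block_grid_def sum.cartesian_product split_def)

text \<open>Summing over \<open>i\<close> and \<open>j\<close> counts the coefficient of
  \<open>z1 powi k\<close> exactly \<open>m + 1 - \<bar>k\<bar>\<close> times, which cancels the
  weight in the diagonal sums.\<close>

lemma torus_sum_gram:
  assumes G: "\<And>l i j. i \<le> m \<Longrightarrow> j \<le> m \<Longrightarrow> block_diag_sum L G l i j
      = p (int i - int j) l / of_real (real m + 1 - \<bar>real_of_int (int i - int j)\<bar>)"
    and z: "cmod z1 = 1" "cmod z2 = 1"
  shows "(\<Sum>x\<in>block_grid m L. \<Sum>y\<in>block_grid m L.
      G x y * ((z1 ^ fst x * z2 ^ snd x) * cnj (z1 ^ fst y * z2 ^ snd y))) = tpoly p m L z1 z2"
proof -
  define f where "f k = (\<Sum>l\<in>{- int L..int L}. p k l / of_real (real m + 1 - \<bar>real_of_int k\<bar>) * z2 powi l) * z1 powi k" for k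
  have "(\<Sum>x\<in>block_grid m L. \<Sum>y\<in>block_grid m L.
      G x y * ((z1 ^ fst x * z2 ^ snd x) * cnj (z1 ^ fst y * z2 ^ snd y)))
    = (\<Sum>i\<le>m. \<Sum>a\<le>L. \<Sum>j\<le>m. \<Sum>b\<le>L. G (i, a) (j, b) * z2 powi (int a - int b) * z1 powi (int i - int j))"
    by (simp add: sum_block_grid powi_diff_unit z mult_ac)
  also have "\<dots> = (\<Sum>i\<le>m. \<Sum>j\<le>m. \<Sum>a\<le>L. \<Sum>b\<le>L. G (i, a) (j, b) * z2 powi (int a - int b) * z1 powi (int i - int j))"
    by (rule sum.cong[OF refl], rule sum.swap)
  \<comment> \<open>The factor \<open>1\<close> gives the sum the shape of
    \<open>sum_collect_diagonals\<close> with a constant \<open>F\<close>.\<close>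
  also have "\<dots> = (\<Sum>i\<le>m. \<Sum>j\<le>m. 1 * f (int i - int j))"
  proof (intro sum.cong refl)
    fix i j assume ij: "i \<in> {..m}" "j \<in> {..m}"
    have "(\<Sum>a\<le>L. \<Sum>b\<le>L. G (i, a) (j, b) * z2 powi (int a - int b) * z1 powi (int i - int j))
        = (\<Sum>a\<le>L. \<Sum>b\<le>L. G (i, a) (j, b) * z2 powi (int a - int b)) * z1 powi (int i - int j)"
      by (simp only: sum_distrib_right)
    also have "\<dots> = (\<Sum>l\<in>{- int L..int L}. block_diag_sum L G l i j * z2 powi l) * z1 powi (int i - int j)"
      unfolding sum_collect_diagonals[where F = "\<lambda>a b. G (i, a) (j, b)" and g = "\<lambda>l. z2 powi l"]
        block_diag_sum_def ..
    also have "\<dots> = 1 * f (int i - int j)"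
      using ij by (simp add: f_def G)
    finally show "(\<Sum>a\<le>L. \<Sum>b\<le>L. G (i, a) (j, b) * z2 powi (int a - int b) * z1 powi (int i - int j))
        = 1 * f (int i - int j)" .
  qed
  also have "\<dots> = (\<Sum>k\<in>{- int m..int m}. (\<Sum>i\<le>m. \<Sum>j\<le>m. if int i - int j = k then 1 else 0) * f k)"
    by (rule sum_collect_diagonals)
  also have "\<dots> = (\<Sum>k\<in>{- int m..int m}. \<Sum>l\<in>{- int L..int L}. p k l * z1 powi k * z2 powi l)"
  proof (intro sum.cong refl)
    fix k assume "k \<in> {- int m..int m}"
    then have k: "\<bar>k\<bar> \<le> int m" by auto
    define w where "w = complex_of_real (real m + 1 - \<bar>real_of_int k\<bar>)"
    have "w \<noteq> 0"
      unfolding w_def of_real_eq_0_iff using k by linarith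
    then have "w * 1 * f k = (\<Sum>l\<in>{- int L..int L}. p k l * z1 powi k * z2 powi l)"
      unfolding f_def w_def[symmetric] by (simp add: sum_distrib_left sum_distrib_right mult_ac)
    then show "(\<Sum>i\<le>m. \<Sum>j\<le>m. if int i - int j = k then 1 else 0) * f k
        = (\<Sum>l\<in>{- int L..int L}. p k l * z1 powi k * z2 powi l)"
      unfolding sum_diagonal[OF k] w_def .
  qed
  finally show ?thesis by (simp add: tpoly_def)
qed

lemma torus_sum_of_squares:
  assumes supp: "supp_le p n d"
    and real: "\<And>z1 z2. cmod z1 = 1 \<Longrightarrow> cmod z2 = 1 \<Longrightarrow> tpoly p n d z1 z2 \<in> \<real>"
    and low: "\<And>z1 z2. cmod z1 = 1 \<Longrightarrow> cmod z2 = 1 \<Longrightarrow> \<epsilon> \<le> Re (tpoly p n d z1 z2)"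
    and C: "\<And>k z. k \<in> {- int n..int n} \<Longrightarrow> cmod z = 1 \<Longrightarrow>
      cmod (\<Sum>l\<in>{- int d..int d}. p k l * z powi l) \<le> C"
    and "n < m" and gap: "real n * (real n + 1) * C / (2 * (real m - real n)) < \<epsilon>"
  shows "\<exists>q. \<forall>z1 z2. cmod z1 = 1 \<longrightarrow> cmod z2 = 1 \<longrightarrow>
    tpoly p n d z1 z2 = of_real (\<Sum>k\<le>m. (cmod (\<Sum>i\<le>m. \<Sum>a\<le>d. q k i a * z2 ^ a * z1 ^ i))\<^sup>2)"
proof -
  \<comment> \<open>The coefficients of the symbol of the Toeplitz matrix in \<open>z1\<close>;
    \<open>fejer\<close> then weights them in \<open>z2\<close> as well.\<close>
  define s where "s k l = p k l / of_real (real m + 1 - \<bar>real_of_int k\<bar>)" for k l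
  define N where "N = real m + 1 - real ((n + 1) div 2)"
  have N: "N > 0" using assms(5) by (simp add: N_def)
  define \<eta> where "\<eta> = (\<epsilon> - real n * (real n + 1) * C / (2 * (real m - real n))) / N"
  have \<eta>: "\<eta> > 0" using gap N by (simp add: \<eta>_def)
  have supps: "supp_le s n d" using supp by (auto simp: supp_le_def s_def)
  have herm: "cnj (s k l) = s (- k) (- l)" for k l
    by (simp only: s_def complex_cnj_divide tpoly_real_imp_hermitian[OF supp real]
        complex_cnj_complex_of_real of_int_minus abs_minus_cancel)
  have "\<eta> \<le> Re (tpoly s n d z1 z2)" if z: "cmod z1 = 1" "cmod z2 = 1" for z1 z2
  proof -
    let ?p = "\<lambda>k. \<Sum>l\<in>{- int d..int d}. p k l * z2 powi l"
    have C0: "0 \<le> C" using order_trans[OF norm_ge_zero C[of 0 1]] by simp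
    have "tpoly p n d z1 z2 = (\<Sum>k\<in>{- int n..int n}. ?p k * z1 powi k)"
      by (simp add: tpoly_def sum_distrib_left mult_ac)
    then have "\<epsilon> \<le> Re (\<Sum>k\<in>{- int n..int n}. ?p k * z1 powi k)"
      using low[OF z] by simp
    from fejer_weighted_lower_bound[OF assms(5) z(1) C0 C[OF _ z(2)] this]
    have "\<eta> \<le> Re (\<Sum>k\<in>{- int n..int n}. ?p k / of_real (real m + 1 - \<bar>real_of_int k\<bar>) * z1 powi k)"
      using N by (simp add: \<eta>_def N_def pos_divide_le_eq mult.commute)
    also have "(\<Sum>k\<in>{- int n..int n}. ?p k / of_real (real m + 1 - \<bar>real_of_int k\<bar>) * z1 powi k) = tpoly s n d z1 z2"
      by (simp add: tpoly_def s_def sum_distrib_left sum_divide_distrib mult_ac)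
    finally show ?thesis .
  qed
  from fejer_positive[OF supps \<eta> this] obtain L c where L: "d \<le> L" "c > 0"
    and pos: "\<And>z1 z2. cmod z1 = 1 \<Longrightarrow> cmod z2 = 1 \<Longrightarrow> c \<le> Re (tpoly (fejer L s) n d z1 z2)"
    by blast
  let ?J = "block_grid m 0" and ?I = "block_grid m L" and ?A = "\<lambda>l i j. s (int i - int j) l"
  obtain q where gram: "gram m L c ?A (\<lambda>x y. \<Sum>k\<in>?J. q k x * cnj (q k y))"
    and ker: "\<forall>u. (\<forall>j\<in>?J. (\<Sum>k\<in>?J. u k * cnj (q k j)) = 0) \<longrightarrow> (\<forall>k\<in>?J. u k = 0)"
    using gram_extremal[OF gram_toeplitz_fejer[OF supps herm L pos] L(2)] by blast
  \<comment> \<open>Blocks beyond \<open>d\<close> vanish in the factor, so the auxiliary size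
    \<open>L\<close> leaves no trace in the degrees.\<close>
  have "q k (i, a) = 0" if "k \<in> ?J" "i \<le> m" "d < a" "a \<le> L" for k i a
  proof (rule gram_factor_degree[OF gram _ _ that])
    show "?A l i j = 0" if "l > int d" for l i j
      using supps that by (simp add: supp_le_def)
  qed (use ker in blast)
  then have cut: "(\<Sum>x\<in>?I. q k x * (z1 ^ fst x * z2 ^ snd x)) = (\<Sum>i\<le>m. \<Sum>a\<le>d. q k (i, a) * z2 ^ a * z1 ^ i)"
    if "k \<in> ?J" for k z1 z2
  proof -
    have "(\<Sum>x\<in>?I. q k x * (z1 ^ fst x * z2 ^ snd x)) = (\<Sum>i\<le>m. \<Sum>a\<le>L. q k (i, a) * z2 ^ a * z1 ^ i)"
      by (simp add: sum_block_grid mult_ac)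
    also have "\<dots> = (\<Sum>i\<le>m. \<Sum>a\<le>d. q k (i, a) * z2 ^ a * z1 ^ i)"
      using \<open>\<And>k i a. k \<in> ?J \<Longrightarrow> i \<le> m \<Longrightarrow> d < a \<Longrightarrow> a \<le> L \<Longrightarrow> q k (i, a) = 0\<close> that L(1)
      by (intro sum.cong refl sum.mono_neutral_right) auto
    finally show ?thesis .
  qed
  show ?thesis
  \<comment> \<open>The columns of the factor are indexed by the corner block, whose
    \<open>m + 1\<close> elements are the pairs \<open>(k, 0)\<close>; each column gives one
    square.\<close>
  proof (intro exI[of _ "\<lambda>k i a. q (k, 0) (i, a)"] allI impI)
    fix z1 z2 :: complex assume z: "cmod z1 = 1" "cmod z2 = 1"
    let ?e = "\<lambda>x. z1 ^ fst x * z2 ^ snd x"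
    have "tpoly p n d z1 z2 = tpoly p m L z1 z2"
      using tpoly_enlarge[OF supp _ L(1), of m] assms(5) by simp
    also have "\<dots> = (\<Sum>x\<in>?I. \<Sum>y\<in>?I. (\<Sum>k\<in>?J. q k x * cnj (q k y)) * (?e x * cnj (?e y)))"
      using gram by (intro torus_sum_gram[symmetric] z) (simp add: gram_def s_def)
    also have "\<dots> = (\<Sum>x\<in>?I. \<Sum>y\<in>?I. \<Sum>k\<in>?J. (q k x * ?e x) * cnj (q k y * ?e y))"
      unfolding sum_distrib_right by (intro sum.cong refl) simp
    also have "\<dots> = (\<Sum>x\<in>?I. \<Sum>k\<in>?J. \<Sum>y\<in>?I. (q k x * ?e x) * cnj (q k y * ?e y))"
      by (rule sum.cong[OF refl], rule sum.swap)
    also have "\<dots> = (\<Sum>k\<in>?J. \<Sum>x\<in>?I. \<Sum>y\<in>?I. (q k x * ?e x) * cnj (q k y * ?e y))"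
      by (rule sum.swap)
    also have "\<dots> = (\<Sum>k\<in>?J. of_real ((cmod (\<Sum>x\<in>?I. q k x * ?e x))\<^sup>2))"
      unfolding complex_norm_square cnj_sum sum_product ..
    also have "\<dots> = (\<Sum>k\<in>?J. of_real ((cmod (\<Sum>i\<le>m. \<Sum>a\<le>d. q k (i, a) * z2 ^ a * z1 ^ i))\<^sup>2))"
      by (intro sum.cong refl) (simp add: cut)
    also have "?J = (\<lambda>k. (k, 0)) ` {..m}" by (auto simp: block_grid_def)
    also have "(\<Sum>k\<in>\<dots>. complex_of_real ((cmod (\<Sum>i\<le>m. \<Sum>a\<le>d. q k (i, a) * z2 ^ a * z1 ^ i))\<^sup>2))
        = (\<Sum>k\<le>m. of_real ((cmod (\<Sum>i\<le>m. \<Sum>a\<le>d. q (k, 0) (i, a) * z2 ^ a * z1 ^ i))\<^sup>2))"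
      by (subst sum.reindex) (auto simp: inj_on_def)
    finally show "tpoly p n d z1 z2 = of_real (\<Sum>k\<le>m. (cmod (\<Sum>i\<le>m. \<Sum>a\<le>d. q (k, 0) (i, a) * z2 ^ a * z1 ^ i))\<^sup>2)"
      by (simp only: of_real_sum)
  qed
qed

section \<open>Translation to polynomials and Laurent polynomials\<close>

definition poly2_of :: "nat \<Rightarrow> nat \<Rightarrow> (nat \<Rightarrow> nat \<Rightarrow> complex) \<Rightarrow> complex poly poly" where
  "poly2_of m d c = (\<Sum>i\<le>m. monom (\<Sum>a\<le>d. monom (c i a) a) i)"

lemma coeff_poly2_of: "coeff (poly2_of m d c) i = (if i \<le> m then \<Sum>a\<le>d. monom (c i a) a else 0)"
  by (simp add: poly2_of_def coeff_sum if_distrib[of "\<lambda>q. coeff q i"] sum.delta)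

lemma degree_poly2_of: "degree (poly2_of m d c) \<le> m"
  by (rule degree_le) (simp add: coeff_poly2_of)

lemma degree2_poly2_of: "degree2_le (poly2_of m d c) d"
  unfolding degree2_le_def coeff_poly2_of
  by (auto intro!: degree_sum_le order_trans[OF degree_monom_le])

lemma poly2_eval_poly2_of:
  "poly2_eval (poly2_of m d c) z1 z2 = (\<Sum>i\<le>m. \<Sum>a\<le>d. c i a * z2 ^ a * z1 ^ i)"
proof -
  let ?f = "\<lambda>q. poly q z2"
  have "degree (map_poly ?f (poly2_of m d c)) \<le> m"
    by (rule degree_le) (simp add: coeff_map_poly coeff_poly2_of)
  from poly_as_sum_of_monoms'[OF this]
  have "poly2_eval (poly2_of m d c) z1 z2
      = poly (\<Sum>i\<le>m. monom (coeff (map_poly ?f (poly2_of m d c)) i) i) z1"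
    by (simp add: poly2_eval_def)
  then show ?thesis
    by (simp add: poly_sum poly_monom coeff_map_poly coeff_poly2_of sum_distrib_right)
qed

lemma laurent_eval_eq_sum:
  assumes "laurent_deg_le p n"
  shows "laurent_eval p z = (\<Sum>j\<in>{- int n..int n}. Poly_Mapping.lookup p j * z powi j)"
  unfolding laurent_eval_def using assms
  by (intro sum.mono_neutral_left) (auto simp: laurent_deg_le_def in_keys_iff)

lemma laurent2_eval_eq_tpoly:
  assumes "laurent_deg_le P n1"
    and "\<And>k. k \<in> {- int n1..int n1} \<Longrightarrow> laurent_deg_le (Poly_Mapping.lookup P k) n2"
  shows "laurent2_eval P z1 z2 = tpoly (\<lambda>k l. Poly_Mapping.lookup (Poly_Mapping.lookup P k) l) n1 n2 z1 z2"
proof -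
  have "laurent2_eval P z1 z2 = (\<Sum>k\<in>{- int n1..int n1}. laurent_eval (Poly_Mapping.lookup P k) z2 * z1 powi k)"
    unfolding laurent2_eval_def using assms(1)
    by (intro sum.mono_neutral_left) (auto simp: laurent_deg_le_def in_keys_iff laurent_eval_def)
  also have "\<dots> = tpoly (\<lambda>k l. Poly_Mapping.lookup (Poly_Mapping.lookup P k) l) n1 n2 z1 z2"
    unfolding tpoly_def
    by (intro sum.cong refl)
       (simp add: laurent_eval_eq_sum[OF assms(2)] sum_distrib_left mult_ac)
  finally show ?thesis .
qed

theorem theorem2p1:
  fixes n1 n2 m1 :: nat and P :: laurent2 and \<epsilon> C1 :: real
  assumes "laurent_deg_le P n1"
    and "\<And>k. k \<in> {- int n1..int n1} \<Longrightarrow> laurent_deg_le (Poly_Mapping.lookup P k) n2"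
    and "\<epsilon> > 0"
    and "\<And>z1 z2. cmod z1 = 1 \<Longrightarrow> cmod z2 = 1 \<Longrightarrow>
           laurent2_eval P z1 z2 \<in> \<real> \<and> Re (laurent2_eval P z1 z2) \<ge> \<epsilon>"
    and "C1 = (SUP (i, z2) \<in> {- int n1..int n1} \<times> {z. cmod z = 1}.
                 cmod (laurent_eval (Poly_Mapping.lookup P i) z2))"
    and "m1 > n1"
    and "real n1 * (real n1 + 1) * C1 / (2 * (real m1 - real n1)) < \<epsilon>"
  shows "\<exists>(M::nat) (Q :: nat \<Rightarrow> complex poly poly).
           M \<le> m1 + 1 \<and>
           (\<forall>k\<in>{1..M}. degree (Q k) \<le> m1 \<and> degree2_le (Q k) n2) \<and>
           (\<forall>z1 z2. cmod z1 = 1 \<longrightarrow> cmod z2 = 1 \<longrightarrow>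
              laurent2_eval P z1 z2 = of_real (\<Sum>k=1..M. (cmod (poly2_eval (Q k) z1 z2))\<^sup>2))"
proof -
  let ?p = "\<lambda>k l. Poly_Mapping.lookup (Poly_Mapping.lookup P k) l"
  have eval: "laurent2_eval P z1 z2 = tpoly ?p n1 n2 z1 z2" for z1 z2
    by (rule laurent2_eval_eq_tpoly) (use assms(1,2) in auto)
  have supp: "supp_le ?p n1 n2"
    unfolding supp_le_def
  proof (intro allI impI)
    fix k l assume kl: "\<bar>k\<bar> > int n1 \<or> \<bar>l\<bar> > int n2"
    show "?p k l = 0"
    proof (cases "k \<in> {- int n1..int n1}")
      case True
      then have "l \<notin> Poly_Mapping.keys (Poly_Mapping.lookup P k)"
        using assms(2)[OF True] kl True unfolding laurent_deg_le_def by force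
      then show ?thesis by (simp add: in_keys_iff)
    next
      case False
      then have "k \<notin> Poly_Mapping.keys P" using assms(1) by (auto simp: laurent_deg_le_def)
      then show ?thesis by (simp add: in_keys_iff)
    qed
  qed
  \<comment> \<open>A bound uniform in \<open>k\<close> and \<open>z\<close>, which makes the
    supremum \<open>C1\<close> a genuine upper bound.\<close>
  have bound: "cmod (laurent_eval (Poly_Mapping.lookup P k) z)
      \<le> (\<Sum>k\<in>{- int n1..int n1}. \<Sum>l\<in>{- int n2..int n2}. cmod (?p k l))"
    if k: "k \<in> {- int n1..int n1}" and z: "cmod z = 1" for k z
  proof -
    have "cmod (laurent_eval (Poly_Mapping.lookup P k) z) \<le> (\<Sum>l\<in>{- int n2..int n2}. cmod (?p k l))"
      unfolding laurent_eval_eq_sum[OF assms(2)[OF k]]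
      by (intro sum_norm_le) (simp add: norm_mult norm_powi_1 z)
    also have "\<dots> \<le> (\<Sum>k\<in>{- int n1..int n1}. \<Sum>l\<in>{- int n2..int n2}. cmod (?p k l))"
      by (rule member_le_sum[OF k]) (auto intro: sum_nonneg)
    finally show ?thesis .
  qed
  have C: "cmod (\<Sum>l\<in>{- int n2..int n2}. ?p k l * z powi l) \<le> C1"
    if k: "k \<in> {- int n1..int n1}" and z: "cmod z = 1" for k z
  proof -
    let ?g = "\<lambda>(i, z2). cmod (laurent_eval (Poly_Mapping.lookup P i) z2)"
    have "bdd_above (?g ` ({- int n1..int n1} \<times> {z. cmod z = 1}))"
      by (rule bdd_aboveI2) (auto intro: bound)
    then have "?g (k, z) \<le> C1"
      unfolding assms(5) by (rule cSUP_upper[rotated]) (use k z in auto)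
    then show ?thesis using laurent_eval_eq_sum[OF assms(2)[OF k]] by simp
  qed
  have "\<exists>q. \<forall>z1 z2. cmod z1 = 1 \<longrightarrow> cmod z2 = 1 \<longrightarrow>
    tpoly ?p n1 n2 z1 z2 = of_real (\<Sum>k\<le>m1. (cmod (\<Sum>i\<le>m1. \<Sum>a\<le>n2. q k i a * z2 ^ a * z1 ^ i))\<^sup>2)"
    by (rule torus_sum_of_squares[OF supp _ _ C assms(6,7)]) (use assms(4) eval in auto)
  then obtain q where q: "\<And>z1 z2. cmod z1 = 1 \<Longrightarrow> cmod z2 = 1 \<Longrightarrow>
    tpoly ?p n1 n2 z1 z2 = of_real (\<Sum>k\<le>m1. (cmod (\<Sum>i\<le>m1. \<Sum>a\<le>n2. q k i a * z2 ^ a * z1 ^ i))\<^sup>2)"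
    by blast
  \<comment> \<open>The squares are numbered from \<open>0\<close> to \<open>m1\<close> in
    \<open>q\<close> but from \<open>1\<close> to \<open>m1 + 1\<close> in the claim.\<close>
  define Q where "Q k = poly2_of m1 n2 (q (k - 1))" for k
  have "laurent2_eval P z1 z2 = of_real (\<Sum>k=1..m1 + 1. (cmod (poly2_eval (Q k) z1 z2))\<^sup>2)"
    if "cmod z1 = 1" "cmod z2 = 1" for z1 z2
  proof -
    have sum_eq: "(\<Sum>k=1..m1 + 1. (cmod (poly2_eval (Q k) z1 z2))\<^sup>2)
        = (\<Sum>k\<le>m1. (cmod (poly2_eval (Q (Suc k)) z1 z2))\<^sup>2)"
      by (rule sum.reindex_bij_witness[of _ Suc "\<lambda>k. k - 1"]) auto
    show ?thesis
      unfolding eval sum_eq by (simp only: q[OF that] Q_def diff_Suc_1 poly2_eval_poly2_of)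
  qed
  then show ?thesis
    by (intro exI[of _ "m1 + 1"] exI[of _ Q]) (simp add: Q_def degree_poly2_of degree2_poly2_of)
qed

end
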